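(* Let $p\in(0,1)$, $\lambda>0$, let $\mu_1,\mu_{-1}\in\mathbb{R}^d$ be such that there is no $c\in\mathbb{R}$ with $\mu_1=c\,\mu_{-1}$ or $\mu_{-1}=c\,\mu_1$, and let $\Sigma_1,\Sigma_{-1}\in\mathbb{R}^{d\times d}$ be symmetric positive definite. For $\alpha\in[0,1]^2$ let $N_\alpha=p\alpha_1\Sigma_1+(1-p)\alpha_{-1}\Sigma_{-1}+\lambda I$. Suppose that $$\sup_{\alpha\in[0,1]^2}\ \mu_1^\top N_\alpha^{-1}\mu_{-1}<0 .$$ Then every solution $\alpha:[0,\infty)\to[0,1]^2$ of the reduced walk-up rate dynamics with $\alpha(0)\in(0,1)^2$ satisfies $\alpha(t)\to(1,1)$ as $t\to\infty$.
   Context: There are two user classes $1$ (popular) and $-1$ (niche); $p\in(0,1)$ is the fraction of class-$1$ users. User features are Gaussian: $X\mid y=i\sim\mathcal N(\mu_i,\Sigma_i)$ for $i\in\{1,-1\}$. The state is the pair of walk-up rates $\alpha=(\alpha_1,\alpha_{-1})\in[0,1]^2$. For $\alpha\in[0,1]^2$ set $$A_\alpha=p\alpha_1(\Sigma_1+\mu_1\mu_1^\top)+(1-p)\alpha_{-1}(\Sigma_{-1}+\mu_{-1}\mu_{-1}^\top)+\lambda I,\quad b_\alpha=p\alpha_1\mu_1-(1-p)\alpha_{-1}\mu_{-1},\quad F(\alpha)=A_\alpha^{-1}b_\alpha .$$ ($F(\alpha)$ is the minimiser of the expected regularised squared loss of the linear classifier when the walk-up rates are $\alpha$.) For $\theta\in\mathbb{R}^d$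 let $\hat p_1(\theta)=\mathbb P_{X\sim\mathcal N(\mu_1,\Sigma_1)}[\theta^\top X\ge 0]$ and $\hat p_{-1}(\theta)=\mathbb P_{X\sim\mathcal N(\mu_{-1},\Sigma_{-1})}[\theta^\top X<0]$. The reduced walk-up rate dynamics (obtained by two-time-scale separation, with the classifier parameter $\theta$ fast and $\alpha$ slow) are $$\dot\alpha_1=\Gamma\{p\,\alpha_1(2\hat p_1(\theta)-1)\},\qquad \dot\alpha_{-1}=\Gamma\{(1-p)\,\alpha_{-1}(2\hat p_{-1}(\theta)-1)\},\qquad \theta=F(\alpha),$$ where $\Gamma$ denotes projection of the dynamics keeping each $\alpha_i$ in $[0,1]$: the velocity component is unchanged when $0<\alpha_i<1$, is replaced by its positive part when $\alpha_i=0$, and by $\min(\cdot,0)$ of it when $\alpha_i=1$. A solution is an absolutely continuous function satisfying these equations for almost every $t\ge0$. *)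

theory Defs
  imports "HOL-Analysis.Analysis"
begin

text \<open>Throughout, the subscripts \<open>1\<close> and \<open>m\<close> stand for the user classes \<open>1\<close> and \<open>-1\<close>, and a
  state \<open>\<alpha> :: real \<times> real\<close> is the pair of walk-up rates of class \<open>1\<close> and class \<open>-1\<close>, in that order.\<close>

definition sym_pos_def :: "real^'d^'d \<Rightarrow> bool" where
  "sym_pos_def S \<longleftrightarrow> transpose S = S \<and> (\<forall>x. x \<noteq> 0 \<longrightarrow> x \<bullet> (S *v x) > 0)"

definition outer :: "real^'d \<Rightarrow> real^'d^'d" where
  "outer v = (\<chi> i j. v $ i * v $ j)"

text \<open>The nondegenerate normal distribution \<open>N(\<mu>, S)\<close> via its Lebesgue density; only meaningful for
  symmetric positive definite \<open>S\<close>.\<close>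

definition multi_normal_density :: "real^'d \<Rightarrow> real^'d^'d \<Rightarrow> real^'d \<Rightarrow> real" where
  "multi_normal_density \<mu> S x =
     exp (- ((x - \<mu>) \<bullet> (matrix_inv S *v (x - \<mu>))) / 2) / sqrt ((2 * pi) ^ CARD('d) * det S)"

definition multi_normal :: "real^'d \<Rightarrow> real^'d^'d \<Rightarrow> (real^'d) measure" where
  "multi_normal \<mu> S = density lborel (\<lambda>x. ennreal (multi_normal_density \<mu> S x))"

text \<open>Probability that the linear classifier \<open>\<theta>\<close> classifies a class \<open>1\<close> (resp. class \<open>-1\<close>) user
  correctly; ties \<open>\<theta> \<bullet> x = 0\<close> are assigned to class \<open>1\<close>.\<close>

definition phat\<^sub>1 :: "real^'d \<Rightarrow> real^'d^'d \<Rightarrow> real^'d \<Rightarrow> real" where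
  "phat\<^sub>1 \<mu>\<^sub>1 S\<^sub>1 \<theta> = measure (multi_normal \<mu>\<^sub>1 S\<^sub>1) {x. \<theta> \<bullet> x \<ge> 0}"

definition phat\<^sub>m :: "real^'d \<Rightarrow> real^'d^'d \<Rightarrow> real^'d \<Rightarrow> real" where
  "phat\<^sub>m \<mu>\<^sub>m S\<^sub>m \<theta> = measure (multi_normal \<mu>\<^sub>m S\<^sub>m) {x. \<theta> \<bullet> x < 0}"

definition A_mat :: "real \<Rightarrow> real \<Rightarrow> real^'d \<Rightarrow> real^'d \<Rightarrow> real^'d^'d \<Rightarrow> real^'d^'d
    \<Rightarrow> real \<times> real \<Rightarrow> real^'d^'d" where
  "A_mat p l \<mu>\<^sub>1 \<mu>\<^sub>m S\<^sub>1 S\<^sub>m \<alpha> =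
     (p * fst \<alpha>) *\<^sub>R (S\<^sub>1 + outer \<mu>\<^sub>1) + ((1 - p) * snd \<alpha>) *\<^sub>R (S\<^sub>m + outer \<mu>\<^sub>m) + l *\<^sub>R mat 1"

definition b_vec :: "real \<Rightarrow> real^'d \<Rightarrow> real^'d \<Rightarrow> real \<times> real \<Rightarrow> real^'d" where
  "b_vec p \<mu>\<^sub>1 \<mu>\<^sub>m \<alpha> = (p * fst \<alpha>) *\<^sub>R \<mu>\<^sub>1 - ((1 - p) * snd \<alpha>) *\<^sub>R \<mu>\<^sub>m"

definition F_cls :: "real \<Rightarrow> real \<Rightarrow> real^'d \<Rightarrow> real^'d \<Rightarrow> real^'d^'d \<Rightarrow> real^'d^'d
    \<Rightarrow> real \<times> real \<Rightarrow> real^'d" where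
  "F_cls p l \<mu>\<^sub>1 \<mu>\<^sub>m S\<^sub>1 S\<^sub>m \<alpha> = matrix_inv (A_mat p l \<mu>\<^sub>1 \<mu>\<^sub>m S\<^sub>1 S\<^sub>m \<alpha>) *v b_vec p \<mu>\<^sub>1 \<mu>\<^sub>m \<alpha>"

definition N_mat :: "real \<Rightarrow> real \<Rightarrow> real^'d^'d \<Rightarrow> real^'d^'d \<Rightarrow> real \<times> real \<Rightarrow> real^'d^'d" where
  "N_mat p l S\<^sub>1 S\<^sub>m \<alpha> = (p * fst \<alpha>) *\<^sub>R S\<^sub>1 + ((1 - p) * snd \<alpha>) *\<^sub>R S\<^sub>m + l *\<^sub>R mat 1"

text \<open>The projection \<open>\<Gamma>\<close> of a velocity component \<open>v\<close> at a coordinate \<open>a \<in> [0,1]\<close>.\<close>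

definition proj_velocity :: "real \<Rightarrow> real \<Rightarrow> real" where
  "proj_velocity a v = (if a = 0 then max v 0 else if a = 1 then min v 0 else v)"

definition walkup_field :: "real \<Rightarrow> real \<Rightarrow> real^'d \<Rightarrow> real^'d \<Rightarrow> real^'d^'d \<Rightarrow> real^'d^'d
    \<Rightarrow> real \<times> real \<Rightarrow> real \<times> real" where
  "walkup_field p l \<mu>\<^sub>1 \<mu>\<^sub>m S\<^sub>1 S\<^sub>m \<alpha> =
     (let \<theta> = F_cls p l \<mu>\<^sub>1 \<mu>\<^sub>m S\<^sub>1 S\<^sub>m \<alpha> in
       (proj_velocity (fst \<alpha>) (p * fst \<alpha> * (2 * phat\<^sub>1 \<mu>\<^sub>1 S\<^sub>1 \<theta> - 1)),
        proj_velocity (snd \<alpha>) ((1 - p) * snd \<alpha> * (2 * phat\<^sub>m \<mu>\<^sub>m S\<^sub>m \<theta> - 1))))"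

text \<open>Absolute continuity of a function on a set of reals (the library's \<open>absolutely_continuous\<close> is
  about measures).\<close>

definition abs_cont_on :: "real set \<Rightarrow> (real \<Rightarrow> 'a::real_normed_vector) \<Rightarrow> bool" where
  "abs_cont_on S f \<longleftrightarrow>
     (\<forall>\<epsilon>>0. \<exists>\<delta>>0. \<forall>(n::nat) a b.
        (\<forall>i<n. a i \<in> S \<and> b i \<in> S \<and> a i \<le> b i) \<and>
        (\<forall>i<n. \<forall>j<n. i \<noteq> j \<longrightarrow> {a i<..<b i} \<inter> {a j<..<b j} = {}) \<and>
        (\<Sum>i<n. b i - a i) < \<delta>
        \<longrightarrow> (\<Sum>i<n. norm (f (b i) - f (a i))) < \<epsilon>)"

text \<open>Only the values of \<open>\<alpha>\<close> on \<open>[0,\<infinity>)\<close> matter. As usual for functions on a half-line, absolute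
  continuity is required on every compact interval.\<close>

definition walkup_solution :: "real \<Rightarrow> real \<Rightarrow> real^'d \<Rightarrow> real^'d \<Rightarrow> real^'d^'d \<Rightarrow> real^'d^'d
    \<Rightarrow> (real \<Rightarrow> real \<times> real) \<Rightarrow> bool" where
  "walkup_solution p l \<mu>\<^sub>1 \<mu>\<^sub>m S\<^sub>1 S\<^sub>m \<alpha> \<longleftrightarrow>
     (\<forall>t\<ge>0. \<alpha> t \<in> {0..1} \<times> {0..1}) \<and>
     (\<forall>T\<ge>0. abs_cont_on {0..T} \<alpha>) \<and>
     (AE t in lebesgue. t \<ge> 0 \<longrightarrow>
        (\<alpha> has_vector_derivative walkup_field p l \<mu>\<^sub>1 \<mu>\<^sub>m S\<^sub>1 S\<^sub>m (\<alpha> t)) (at t within {0..}))"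

end

theory Submission
  imports Defs "HOL-Probability.Distributions"
begin

text \<open>With \<open>a = p \<alpha>\<^sub>1\<close>, \<open>b = (1 - p) \<alpha>\<^sub>m\<close> and \<open>\<theta> = F \<alpha>\<close>, the equation \<open>A \<theta> = a \<mu>\<^sub>1 - b \<mu>\<^sub>m\<close> is a rank-two
  perturbation of one for \<open>N\<close>, so the margins \<open>\<mu>\<^sub>1 \<bullet> \<theta>\<close> and \<open>\<mu>\<^sub>m \<bullet> \<theta>\<close> solve a \<open>2 \<times> 2\<close> linear system whose
  coefficients are the values of the form \<open>N\<inverse>\<close> on \<open>\<mu>\<^sub>1, \<mu>\<^sub>m\<close>. As the cross term is at most \<open>s < 0\<close>, Cramer's
  rule gives \<open>\<mu>\<^sub>1 \<bullet> \<theta> > 0 > \<mu>\<^sub>m \<bullet> \<theta>\<close>, with bounds uniform in \<open>\<alpha>\<close> as long as both walk-up rates stay away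
  from \<open>0\<close>. By the symmetry of the normal distribution about its mean, both classes are then
  classified correctly with probability uniformly above \<open>1/2\<close>. Hence both coordinates of a solution
  are nondecreasing, stay above their initial values, and grow at a rate bounded below until they
  reach \<open>1\<close>, which happens in finite time.\<close>

section \<open>Growth of absolutely continuous functions\<close>

text \<open>\<open>abs_cont_on\<close> speaks of families indexed by initial segments of the
  naturals, while a tagged division is indexed by pairs of a tag and an interval. An enumeration of
  the index set translates between the two.\<close>

lemma abs_cont_on_finite_family:
  assumes "abs_cont_on S f" and "\<epsilon> > 0"
  shows "\<exists>\<delta>>0. \<forall>(I::'i set) l u. finite I \<and> (\<forall>i\<in>I. l i \<in> S \<and> u i \<in> S \<and> l i \<le> u i) \<and>
    disjoint_family_on (\<lambda>i. {l i<..<u i}) I \<and> (\<Sum>i\<in>I. u i - l i) < \<delta>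
    \<longrightarrow> (\<Sum>i\<in>I. norm (f (u i) - f (l i))) < \<epsilon>"
proof -
  from assms(1)[unfolded abs_cont_on_def, THEN spec, THEN mp, OF assms(2)]
  obtain \<delta> where \<delta>: "\<delta> > 0 \<and> (\<forall>(n::nat) a b.
        (\<forall>i<n. a i \<in> S \<and> b i \<in> S \<and> a i \<le> b i) \<and>
        (\<forall>i<n. \<forall>j<n. i \<noteq> j \<longrightarrow> {a i<..<b i} \<inter> {a j<..<b j} = {}) \<and>
        (\<Sum>i<n. b i - a i) < \<delta>
        \<longrightarrow> (\<Sum>i<n. norm (f (b i) - f (a i))) < \<epsilon>)" ..
  show ?thesis
  proof (intro exI[of _ \<delta>] conjI[OF conjunct1[OF \<delta>]] allI impI)
    fix I :: "'i set" and l u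
    assume "finite I \<and> (\<forall>i\<in>I. l i \<in> S \<and> u i \<in> S \<and> l i \<le> u i) \<and>
      disjoint_family_on (\<lambda>i. {l i<..<u i}) I \<and> (\<Sum>i\<in>I. u i - l i) < \<delta>"
    then have I: "finite I" "\<And>i. i \<in> I \<Longrightarrow> l i \<in> S \<and> u i \<in> S \<and> l i \<le> u i"
      "disjoint_family_on (\<lambda>i. {l i<..<u i}) I" "(\<Sum>i\<in>I. u i - l i) < \<delta>"
      by blast+
    obtain h where h: "bij_betw h {..<card I} I"
      using ex_bij_betw_nat_finite[OF I(1)] by (auto simp: atLeast0LessThan)
    have hI: "h i \<in> I" if "i < card I" for i
      using h that by (auto simp: bij_betw_def)
    have inj: "h i \<noteq> h j" if "i < card I" "j < card I" "i \<noteq> j" for i j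
      using h that by (auto simp: bij_betw_def inj_on_def)
    have "(\<Sum>i<card I. norm (f (u (h i)) - f (l (h i)))) < \<epsilon>"
    proof (rule \<delta>[THEN conjunct2, THEN spec[of _ "card I"], THEN spec[of _ "\<lambda>i. l (h i)"],
            THEN spec[of _ "\<lambda>i. u (h i)"], THEN mp], intro conjI allI impI)
      show "(\<Sum>i<card I. u (h i) - l (h i)) < \<delta>"
        using sum.reindex_bij_betw[OF h, of "\<lambda>i. u i - l i"] I(4) by simp
    next
      fix i j assume "i < card I" "j < card I" "i \<noteq> j"
      then show "{l (h i)<..<u (h i)} \<inter> {l (h j)<..<u (h j)} = {}"
        using I(3) hI inj unfolding disjoint_family_on_def by blast
    qed (use I(2) hI in auto)
    then show "(\<Sum>i\<in>I. norm (f (u i) - f (l i))) < \<epsilon>"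
      using sum.reindex_bij_betw[OF h, of "\<lambda>i. norm (f (u i) - f (l i))"] by simp
  qed
qed

text \<open>Disjointness is asked of the open intervals because neighbouring pieces of a division
  share endpoints. Additivity and monotonicity of Lebesgue measure then suffice.\<close>

lemma sum_length_le_measure:
  fixes l u :: "'i \<Rightarrow> real"
  assumes "finite I" and "\<And>i. i \<in> I \<Longrightarrow> l i \<le> u i"
    and "disjoint_family_on (\<lambda>i. {l i<..<u i}) I"
    and "\<And>i. i \<in> I \<Longrightarrow> {l i<..<u i} \<subseteq> U" and "U \<in> sets borel"
  shows "ennreal (\<Sum>i\<in>I. u i - l i) \<le> emeasure lborel U"
proof -
  have "ennreal (\<Sum>i\<in>I. u i - l i) = (\<Sum>i\<in>I. ennreal (u i - l i))"
    using assms(2) by (subst sum_ennreal) auto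
  also have "\<dots> = (\<Sum>i\<in>I. emeasure lborel {l i<..<u i})"
    using assms(2) by (intro sum.cong) auto
  also have "\<dots> = emeasure lborel (\<Union>i\<in>I. {l i<..<u i})"
    using assms(1,3) by (intro sum_emeasure) auto
  also have "\<dots> \<le> emeasure lborel U"
    using assms(4,5) by (intro emeasure_mono) auto
  finally show ?thesis .
qed

text \<open>Cousin's lemma: tags outside the exceptional null set contribute at least the slope times the
  length up to \<open>\<epsilon>\<close>, and the intervals tagged inside it lie in an open set of small measure, so
  absolute continuity makes their contribution negligible.\<close>

lemma abs_cont_on_increment_ge:
  fixes f :: "real \<Rightarrow> real"
  assumes "a \<le> b" and ac: "abs_cont_on {a..b} f"
    and ae: "AE t in lebesgue. t \<in> {a..b} \<longrightarrow>
      (\<exists>D\<ge>k. (f has_real_derivative D) (at t within {a..b}))"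
  shows "k * (b - a) \<le> f b - f a"
proof (rule field_le_epsilon)
  fix e :: real assume "e > 0"
  \<comment> \<open>The final error is \<open>\<epsilon> * (b - a)\<close> from the slopes plus two
    further \<open>\<epsilon>\<close> from the pieces tagged in the null set.\<close>
  define \<epsilon> where "\<epsilon> = e / (b - a + 2)"
  have \<epsilon>: "\<epsilon> > 0" "\<epsilon> * (b - a + 2) = e"
    using \<open>e > 0\<close> \<open>a \<le> b\<close> by (auto simp: \<epsilon>_def)
  from ae[unfolded eventually_ae_filter] obtain N where N: "N \<in> null_sets lebesgue"
    and N0: "{t \<in> space lebesgue. \<not> (t \<in> {a..b} \<longrightarrow>
      (\<exists>D\<ge>k. (f has_real_derivative D) (at t within {a..b})))} \<subseteq> N" ..
  have N_der: "\<exists>D\<ge>k. (f has_real_derivative D) (at t within {a..b})" if "t \<in> {a..b} - N" for t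
    using subsetD[OF N0, of t] that by auto
  from abs_cont_on_finite_family[OF ac \<epsilon>(1)]
  obtain \<delta>0 where \<delta>0: "\<delta>0 > 0 \<and> (\<forall>(I::(real \<times> real set) set) l u.
      finite I \<and> (\<forall>i\<in>I. l i \<in> {a..b} \<and> u i \<in> {a..b} \<and> l i \<le> u i) \<and>
      disjoint_family_on (\<lambda>i. {l i<..<u i}) I \<and> (\<Sum>i\<in>I. u i - l i) < \<delta>0
      \<longrightarrow> (\<Sum>i\<in>I. norm (f (u i) - f (l i))) < \<epsilon>)" ..
  \<comment> \<open>The second bound gives \<open>\<bar>k\<bar> * \<delta> \<le> \<epsilon>\<close>;
    adding 1 to the denominator covers \<open>k = 0\<close>.\<close>
  define \<delta> where "\<delta> = min \<delta>0 (\<epsilon> / (\<bar>k\<bar> + 1))"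
  have \<delta>: "\<delta> > 0" "\<delta> \<le> \<delta>0" "\<bar>k\<bar> * \<delta> \<le> \<epsilon>"
  proof -
    have "\<bar>k\<bar> * \<delta> \<le> \<bar>k\<bar> * (\<epsilon> / (\<bar>k\<bar> + 1))"
      by (intro mult_left_mono) (auto simp: \<delta>_def)
    also have "\<dots> \<le> \<epsilon>"
      using \<epsilon>(1) by (simp add: field_simps)
    finally show "\<bar>k\<bar> * \<delta> \<le> \<epsilon>" .
  qed (use \<delta>0 \<epsilon>(1) in \<open>auto simp: \<delta>_def\<close>)
  obtain U where U: "open U" "N \<subseteq> U" "U - N \<in> lmeasurable"
      "emeasure lebesgue (U - N) < ennreal \<delta>"
    by (rule sets_lebesgue_outer_open[OF null_setsD2[OF N] \<delta>(1)])
  have U_small: "emeasure lborel U < ennreal \<delta>"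
    using U emeasure_Diff_null_set[OF N, of U] by simp
  \<comment> \<open>Differentiability at the tag controls both of its sides, so a short interval
    around the tag has slope at least \<open>k - \<epsilon>\<close> even when the tag is not an
    endpoint.\<close>
  have "\<exists>r>0. \<forall>y\<in>{a..b}. \<bar>y - x\<bar> < r \<longrightarrow>
      (x \<le> y \<longrightarrow> (k - \<epsilon>) * (y - x) \<le> f y - f x) \<and> (y \<le> x \<longrightarrow> (k - \<epsilon>) * (x - y) \<le> f x - f y)"
    if x: "x \<in> {a..b} - N" for x
  proof -
    obtain D where "D \<ge> k" and D: "(f has_derivative (\<lambda>h. D * h)) (at x within {a..b})"
      using N_der[OF x] by (auto simp: has_field_derivative_def)
    then obtain r where "r > 0"
      and r: "\<And>y. y \<in> {a..b} \<Longrightarrow> \<bar>y - x\<bar> < r \<Longrightarrow> \<bar>f y - f x - D * (y - x)\<bar> \<le> \<epsilon> * \<bar>y - x\<bar>"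
      using \<epsilon>(1) unfolding has_derivative_within_alt real_norm_def by blast
    have "(x \<le> y \<longrightarrow> (k - \<epsilon>) * (y - x) \<le> f y - f x) \<and> (y \<le> x \<longrightarrow> (k - \<epsilon>) * (x - y) \<le> f x - f y)"
      if "y \<in> {a..b}" "\<bar>y - x\<bar> < r" for y
    proof -
      have "k * \<bar>y - x\<bar> \<le> D * \<bar>y - x\<bar>"
        using \<open>D \<ge> k\<close> by (intro mult_right_mono) auto
      then show ?thesis
        using r[OF that] by (auto simp: algebra_simps abs_if split: if_splits)
    qed
    then show ?thesis using \<open>r > 0\<close> by blast
  qed
  then obtain r where r_pos: "\<And>x. x \<in> {a..b} - N \<Longrightarrow> r x > 0"
    and r: "\<And>x y. \<lbrakk>x \<in> {a..b} - N; y \<in> {a..b}; \<bar>y - x\<bar> < r x\<rbrakk> \<Longrightarrow>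
      (x \<le> y \<longrightarrow> (k - \<epsilon>) * (y - x) \<le> f y - f x) \<and> (y \<le> x \<longrightarrow> (k - \<epsilon>) * (x - y) \<le> f x - f y)"
    by metis
  \<comment> \<open>A piece tagged in \<open>N\<close> is forced into \<open>U\<close>, any other
    into the range of the slope estimate at its tag. A gauge needs a value at every real; the radius
    1 outside \<open>{a..b}\<close> is arbitrary.\<close>
  define g where "g = (\<lambda>x. if x \<in> N then U else if x \<in> {a..b} then ball x (r x) else ball x 1)"
  have "gauge g"
    unfolding gauge_def g_def using U r_pos by auto
  then obtain P where P: "P tagged_division_of {a..b}" "g fine P"
    using fine_division_exists_real by blast
  \<comment> \<open>\<open>Inf\<close> and \<open>Sup\<close> recover the endpoints in the form in
    which the telescoping sum over a tagged division is stated.\<close>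
  define l where "l = (\<lambda>i::real \<times> real set. Inf (snd i))"
  define u where "u = (\<lambda>i::real \<times> real set. Sup (snd i))"
  have "finite P" using P(1) by auto
  have piece: "l i \<in> {a..b}" "u i \<in> {a..b}" "l i \<le> fst i" "fst i \<le> u i" "snd i = {l i..u i}"
    "fst i \<in> {a..b}" "{l i..u i} \<subseteq> g (fst i)" if i: "i \<in> P" for i
  proof -
    obtain x K where xK: "i = (x, K)" by (cases i)
    obtain c d where K: "K = {c..d}" "x \<in> K" "K \<subseteq> {a..b}"
      using tagged_division_ofD(2-4)[OF P(1)] i xK by (metis box_real(2))
    then have "c \<le> d" by auto
    then have "l i = c" "u i = d" by (auto simp: l_def u_def xK K(1))
    moreover have "K \<subseteq> g x" using P(2) i xK by (auto simp: fine_def)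
    ultimately show "l i \<in> {a..b}" "u i \<in> {a..b}" "l i \<le> fst i" "fst i \<le> u i" "snd i = {l i..u i}"
      "fst i \<in> {a..b}" "{l i..u i} \<subseteq> g (fst i)"
      using K \<open>c \<le> d\<close> xK by auto
  qed
  have disj: "disjoint_family_on (\<lambda>i. {l i<..<u i}) P"
    unfolding disjoint_family_on_def
  proof (intro ballI impI)
    fix i j assume ij: "i \<in> P" "j \<in> P" "i \<noteq> j"
    then have "interior (snd i) \<inter> interior (snd j) = {}"
      using tagged_division_ofD(5)[OF P(1)] by (metis prod.collapse)
    then show "{l i<..<u i} \<inter> {l j<..<u j} = {}"
      using piece(5)[OF ij(1)] piece(5)[OF ij(2)] by (simp add: interior_atLeastAtMost_real)
  qed
  define Q where "Q = {i \<in> P. fst i \<in> N}"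
  have Q: "Q \<subseteq> P" "finite Q" using \<open>finite P\<close> by (auto simp: Q_def)
  have disjQ: "disjoint_family_on (\<lambda>i. {l i<..<u i}) Q"
    using disj Q(1) by (meson disjoint_family_on_mono)
  have leQ: "l i \<le> u i" if "i \<in> P" for i using piece(3,4)[OF that] by linarith
  have "ennreal (\<Sum>i\<in>Q. u i - l i) \<le> emeasure lborel U"
  proof (rule sum_length_le_measure[OF Q(2) _ disjQ])
    fix i assume "i \<in> Q"
    then show "{l i<..<u i} \<subseteq> U"
      using piece(7)[of i] by (fastforce simp: Q_def g_def)
  qed (use leQ Q(1) U(1) in auto)
  then have lenQ: "(\<Sum>i\<in>Q. u i - l i) < \<delta>"
    using U_small \<delta>(1) by (meson ennreal_less_iff leQ Q(1) order_le_less_trans subsetD sum_nonneg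
        diff_ge_0_iff_ge)
  then have varQ: "(\<Sum>i\<in>Q. \<bar>f (u i) - f (l i)\<bar>) < \<epsilon>"
  proof -
    have "\<forall>i\<in>Q. l i \<in> {a..b} \<and> u i \<in> {a..b} \<and> l i \<le> u i"
      using piece(1,2) leQ Q(1) by blast
    then show ?thesis
      using \<delta>0[THEN conjunct2, THEN spec[of _ Q], THEN spec[of _ l], THEN spec[of _ u]]
        Q(2) disjQ lenQ \<delta>(2) by simp
  qed
  have good: "(k - \<epsilon>) * (u i - l i) \<le> f (u i) - f (l i)" if i: "i \<in> P" "fst i \<notin> N" for i
  proof -
    have "l i \<in> ball (fst i) (r (fst i))" "u i \<in> ball (fst i) (r (fst i))"
      using piece(6,7)[OF i(1)] leQ[OF i(1)] i(2) by (auto simp: g_def)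
    then have "\<bar>l i - fst i\<bar> < r (fst i)" "\<bar>u i - fst i\<bar> < r (fst i)"
      by (auto simp: dist_real_def)
    then have "(k - \<epsilon>) * (u i - fst i) \<le> f (u i) - f (fst i)"
      "(k - \<epsilon>) * (fst i - l i) \<le> f (fst i) - f (l i)"
      using r[of "fst i" "l i"] r[of "fst i" "u i"] piece[OF i(1)] i(2) by auto
    then show ?thesis by (simp add: algebra_simps)
  qed
  \<comment> \<open>True of any piece by size alone. Subtracting the two penalties gives the pieces
    tagged in \<open>N\<close> the same main term as the others, so that it can be summed over all
    of \<open>P\<close>.\<close>
  have bad: "(k - \<epsilon>) * (u i - l i) - \<bar>f (u i) - f (l i)\<bar> - \<bar>k\<bar> * (u i - l i) \<le> f (u i) - f (l i)"
    if "i \<in> P" for i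
  proof -
    have "(k - \<epsilon>) * (u i - l i) \<le> \<bar>k\<bar> * (u i - l i)"
      using \<epsilon>(1) leQ[OF that] by (intro mult_right_mono) auto
    then show ?thesis by linarith
  qed
  have indicator_sum: "(\<Sum>i\<in>P. if i \<in> Q then h i else 0) = (\<Sum>i\<in>Q. h i)" for h :: "_ \<Rightarrow> real"
    using Q \<open>finite P\<close> by (simp add: sum.inter_restrict[symmetric] Int_absorb1)
  have "(k - \<epsilon>) * (b - a) - \<epsilon> - \<epsilon> \<le> (k - \<epsilon>) * (\<Sum>i\<in>P. u i - l i)
      - (\<Sum>i\<in>Q. \<bar>f (u i) - f (l i)\<bar>) - \<bar>k\<bar> * (\<Sum>i\<in>Q. u i - l i)"
  proof -
    have "(\<Sum>i\<in>P. u i - l i) = b - a"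
      using additive_tagged_division_1[OF \<open>a \<le> b\<close> P(1), of "\<lambda>x. x"]
      by (simp add: l_def u_def case_prod_beta)
    moreover have "\<bar>k\<bar> * (\<Sum>i\<in>Q. u i - l i) \<le> \<bar>k\<bar> * \<delta>"
      using lenQ by (intro mult_left_mono) auto
    ultimately show ?thesis using varQ \<delta>(3) by simp
  qed
  also have "\<dots> = (\<Sum>i\<in>P. (k - \<epsilon>) * (u i - l i)
      - (if i \<in> Q then \<bar>f (u i) - f (l i)\<bar> + \<bar>k\<bar> * (u i - l i) else 0))"
    by (simp only: sum_subtractf[of "\<lambda>i. (k - \<epsilon>) * (u i - l i)"] indicator_sum sum.distrib
        sum_distrib_left diff_diff_eq)
  also have "\<dots> \<le> (\<Sum>i\<in>P. f (u i) - f (l i))"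
    using good bad by (intro sum_mono) (auto simp: Q_def algebra_simps)
  also have "\<dots> = f b - f a"
    using additive_tagged_division_1[OF \<open>a \<le> b\<close> P(1), of f] by (simp add: l_def u_def case_prod_beta)
  finally show "k * (b - a) \<le> f b - f a + e"
    using \<epsilon>(2) by (simp add: algebra_simps)
qed

text \<open>Covers two reductions: to a subinterval, and to a coordinate of a pair, whose increments
  are dominated by those of the pair.\<close>

lemma abs_cont_on_mono:
  assumes "abs_cont_on S f" and "T \<subseteq> S" and le: "\<And>x y. norm (g x - g y) \<le> norm (f x - f y)"
  shows "abs_cont_on T g"
  unfolding abs_cont_on_def
proof (intro allI impI)
  fix \<epsilon> :: real assume "\<epsilon> > 0"
  from assms(1)[unfolded abs_cont_on_def, THEN spec, THEN mp, OF this]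
  obtain \<delta> where \<delta>: "\<delta> > 0 \<and> (\<forall>(n::nat) a b.
        (\<forall>i<n. a i \<in> S \<and> b i \<in> S \<and> a i \<le> b i) \<and>
        (\<forall>i<n. \<forall>j<n. i \<noteq> j \<longrightarrow> {a i<..<b i} \<inter> {a j<..<b j} = {}) \<and>
        (\<Sum>i<n. b i - a i) < \<delta>
        \<longrightarrow> (\<Sum>i<n. norm (f (b i) - f (a i))) < \<epsilon>)" ..
  show "\<exists>\<delta>>0. \<forall>(n::nat) a b.
        (\<forall>i<n. a i \<in> T \<and> b i \<in> T \<and> a i \<le> b i) \<and>
        (\<forall>i<n. \<forall>j<n. i \<noteq> j \<longrightarrow> {a i<..<b i} \<inter> {a j<..<b j} = {}) \<and>
        (\<Sum>i<n. b i - a i) < \<delta>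
        \<longrightarrow> (\<Sum>i<n. norm (g (b i) - g (a i))) < \<epsilon>"
  proof (intro exI[of _ \<delta>] conjI[OF conjunct1[OF \<delta>]] allI impI)
    fix n :: nat and a b
    assume *: "(\<forall>i<n. a i \<in> T \<and> b i \<in> T \<and> a i \<le> b i) \<and>
        (\<forall>i<n. \<forall>j<n. i \<noteq> j \<longrightarrow> {a i<..<b i} \<inter> {a j<..<b j} = {}) \<and>
        (\<Sum>i<n. b i - a i) < \<delta>"
    have "(\<Sum>i<n. norm (f (b i) - f (a i))) < \<epsilon>"
      by (rule \<delta>[THEN conjunct2, THEN spec[of _ n], THEN spec[of _ a], THEN spec[of _ b], THEN mp])
        (use * assms(2) in auto)
    moreover have "(\<Sum>i<n. norm (g (b i) - g (a i))) \<le> (\<Sum>i<n. norm (f (b i) - f (a i)))"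
      by (intro sum_mono le)
    ultimately show "(\<Sum>i<n. norm (g (b i) - g (a i))) < \<epsilon>" by linarith
  qed
qed

lemma abs_cont_halfline_increment_ge:
  fixes f :: "real \<Rightarrow> real"
  assumes ac: "\<And>T. T \<ge> 0 \<Longrightarrow> abs_cont_on {0..T} f" and st: "0 \<le> s" "s \<le> t"
    and ae: "AE \<tau> in lebesgue. \<tau> \<in> {s..t} \<longrightarrow>
      (\<exists>D\<ge>k. (f has_real_derivative D) (at \<tau> within {0..}))"
  shows "k * (t - s) \<le> f t - f s"
proof (rule abs_cont_on_increment_ge[OF st(2)])
  show "abs_cont_on {s..t} f"
    using st by (intro abs_cont_on_mono[OF ac[of t]]) auto
  show "AE \<tau> in lebesgue. \<tau> \<in> {s..t} \<longrightarrow>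
      (\<exists>D\<ge>k. (f has_real_derivative D) (at \<tau> within {s..t}))"
    using ae
  proof (rule AE_mp, intro AE_I2 impI)
    fix \<tau> assume "\<tau> \<in> {s..t} \<longrightarrow> (\<exists>D\<ge>k. (f has_real_derivative D) (at \<tau> within {0..}))"
      and "\<tau> \<in> {s..t}"
    then obtain D where "D \<ge> k" "(f has_real_derivative D) (at \<tau> within {0..})" by blast
    moreover have "{s..t} \<subseteq> {0..}" using st by auto
    ultimately show "\<exists>D\<ge>k. (f has_real_derivative D) (at \<tau> within {s..t})"
      using has_field_derivative_subset by blast
  qed
qed

text \<open>If \<open>f t < 1\<close>, then by monotonicity \<open>f < 1\<close> on all of
  \<open>{0..t}\<close>, so the slope bound holds throughout and
  \<open>f t \<ge> f 0 + k * t\<close>. This contradicts \<open>f t \<le> 1\<close> once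
  \<open>t > (1 - f 0) / k\<close>.\<close>

lemma nondecreasing_eventually_one:
  fixes f :: "real \<Rightarrow> real"
  assumes ac: "\<And>T. T \<ge> 0 \<Longrightarrow> abs_cont_on {0..T} f" and le1: "\<And>t. t \<ge> 0 \<Longrightarrow> f t \<le> 1"
    and mono: "\<And>s t. 0 \<le> s \<Longrightarrow> s \<le> t \<Longrightarrow> f s \<le> f t" and "k > 0"
    and ae: "AE t in lebesgue. t \<ge> 0 \<and> f t < 1 \<longrightarrow>
      (\<exists>D\<ge>k. (f has_real_derivative D) (at t within {0..}))"
  shows "eventually (\<lambda>t. f t = 1) at_top"
  using eventually_gt_at_top[of "max 0 ((1 - f 0) / k)"]
proof (rule eventually_mono)
  fix t assume t: "t > max 0 ((1 - f 0) / k)"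
  then have "1 - f 0 < k * t" using \<open>k > 0\<close> by (simp add: field_simps)
  have "k * (t - 0) \<le> f t - f 0" if "f t < 1"
  proof (rule abs_cont_halfline_increment_ge[OF ac])
    show "AE \<tau> in lebesgue. \<tau> \<in> {0..t} \<longrightarrow>
      (\<exists>D\<ge>k. (f has_real_derivative D) (at \<tau> within {0..}))"
      using ae
    proof (rule AE_mp, intro AE_I2 impI)
      fix \<tau> assume *: "\<tau> \<ge> 0 \<and> f \<tau> < 1 \<longrightarrow> (\<exists>D\<ge>k. (f has_real_derivative D) (at \<tau> within {0..}))"
        and "\<tau> \<in> {0..t}"
      then have "f \<tau> < 1" using mono[of \<tau> t] \<open>f t < 1\<close> by auto
      then show "\<exists>D\<ge>k. (f has_real_derivative D) (at \<tau> within {0..})"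
        using * \<open>\<tau> \<in> {0..t}\<close> by auto
    qed
  qed (use t in auto)
  then show "f t = 1"
    using \<open>1 - f 0 < k * t\<close> le1[of t] t by force
qed

section \<open>The Gaussian integral\<close>

text \<open>Row \<open>k\<close> lies outside \<open>J\<close> and so stays unchanged while the rows
  of \<open>J\<close> are treated one after another, each by an elementary operation.\<close>

lemma det_add_multiples_of_row:
  fixes A :: "'a::comm_ring_1^'n^'n"
  assumes "k \<notin> J"
  shows "det (\<chi> i. if i \<in> J then row i A + c i *s row k A else row i A) = det A"
proof -
  have "finite J" by simp
  then show ?thesis using assms
  proof (induction J rule: finite_induct)
    case empty
    show ?case by (simp add: row_def vec_nth_inverse)
  next
    case (insert j J)
    define B where "B = (\<chi> i. if i \<in> J then row i A + c i *s row k A else row i A)"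
    have "(\<chi> i. if i \<in> insert j J then row i A + c i *s row k A else row i A)
        = (\<chi> i. if i = j then row j B + c j *s row k B else row i B)"
      using insert.hyps insert.prems by (auto simp: vec_eq_iff B_def row_def)
    then have "det (\<chi> i. if i \<in> insert j J then row i A + c i *s row k A else row i A) = det B"
      using insert.prems det_row_operation[of j k B "c j"] by auto
    then show ?case using insert by (simp add: B_def)
  qed
qed

text \<open>Padding with the identity makes this determinant the principal minor indexed by \<open>J\<close>.\<close>

definition restrict_matrix :: "'n set \<Rightarrow> ('n \<Rightarrow> 'n \<Rightarrow> real) \<Rightarrow> real^'n^'n" where
  "restrict_matrix J P = (\<chi> i j. if i \<in> J \<and> j \<in> J then P i j else if i = j then 1 else 0)"

text \<open>The index type stays the same after \<open>k\<close> is eliminated, so the elimination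
  can be iterated by induction on the set of remaining indices.\<close>

definition schur :: "'n \<Rightarrow> ('n \<Rightarrow> 'n \<Rightarrow> real) \<Rightarrow> 'n \<Rightarrow> 'n \<Rightarrow> real" where
  "schur k P i j = P i j - P i k * P k j / P k k"

text \<open>Gaussian elimination with pivot \<open>P k k\<close>: row operations clear the rest of
  column \<open>k\<close>, column operations the rest of row \<open>k\<close>, and what is left on
  \<open>J\<close> is the Schur complement.\<close>

lemma det_restrict_matrix_insert:
  fixes P :: "'n::finite \<Rightarrow> 'n \<Rightarrow> real"
  assumes "k \<notin> J" and "P k k \<noteq> 0"
  shows "det (restrict_matrix (insert k J) P) = P k k * det (restrict_matrix J (schur k P))"
proof -
  define A where "A = restrict_matrix (insert k J) P"
  define B where "B = (\<chi> i. if i \<in> J then row i A + (- P i k / P k k) *s row k A else row i A)"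
  \<comment> \<open>Column operations are carried out as row operations on the transpose, so
    \<open>C\<close> is the transpose of the reduced matrix.\<close>
  define C where "C = (\<chi> j. if j \<in> J then row j (transpose B) + (- P k j / P k k) *s row k (transpose B)
      else row j (transpose B))"
  have "det A = det C"
    using det_add_multiples_of_row[OF assms(1), where c="\<lambda>i. - P i k / P k k" and A=A]
      det_add_multiples_of_row[OF assms(1), where c="\<lambda>j. - P k j / P k k" and A="transpose B"]
    by (simp add: B_def C_def)
  also have "C = transpose (\<chi> i. if i = k then P k k *s (axis k 1)
      else restrict_matrix J (schur k P) $ i)"
    using assms
    by (auto simp: C_def B_def A_def vec_eq_iff row_def transpose_def restrict_matrix_def schur_def
        axis_def field_simps)
  also have "det \<dots> = P k k * det (\<chi> i. if i = k then axis k 1 else restrict_matrix J (schur k P) $ i)"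
    unfolding det_transpose by (rule det_row_mul)
  also have "(\<chi> i. if i = k then axis k 1 else restrict_matrix J (schur k P) $ i)
      = restrict_matrix J (schur k P)"
    using assms(1) by (auto simp: vec_eq_iff restrict_matrix_def axis_def)
  finally show ?thesis by (simp add: A_def)
qed

text \<open>The argument is a function on indices, as are the points of the product measure
  \<open>PiM J\<close>, so that variables can be removed one at a time.\<close>

definition quad_form :: "'n set \<Rightarrow> ('n \<Rightarrow> 'n \<Rightarrow> real) \<Rightarrow> ('n \<Rightarrow> real) \<Rightarrow> real" where
  "quad_form J P x = (\<Sum>i\<in>J. \<Sum>j\<in>J. P i j * x i * x j)"

text \<open>Completing the square in the variable with index \<open>k\<close>. The update
  \<open>x(k := y)\<close> matches the way an integral over \<open>insert k J\<close> splits into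
  iterated integrals.\<close>

lemma quad_form_insert:
  assumes "finite J" "k \<notin> J" "P k k \<noteq> 0" and sym: "\<And>i j. P i j = P j i"
  shows "quad_form (insert k J) P (x(k := y))
    = quad_form J (schur k P) x + P k k * (y + (\<Sum>j\<in>J. P k j * x j) / P k k)\<^sup>2"
proof -
  define s where "s = (\<Sum>j\<in>J. P k j * x j)"
  have upd: "(\<Sum>j\<in>J. g j ((x(k := y)) j)) = (\<Sum>j\<in>J. g j (x j))" for g :: "'a \<Rightarrow> real \<Rightarrow> real"
    using assms(2) by (intro sum.cong) auto
  have "quad_form (insert k J) P (x(k := y)) = P k k * y\<^sup>2 + (\<Sum>j\<in>J. P k j * y * x j)
      + (\<Sum>i\<in>J. P i k * x i * y + (\<Sum>j\<in>J. P i j * x i * x j))"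
    using assms(1,2) upd[of "\<lambda>j z. P k j * y * z"]
      upd[of "\<lambda>i z. P i k * z * y + (\<Sum>j\<in>J. P i j * z * x j)"]
      upd[of "\<lambda>j z. P i j * (x(k := y)) i * z" for i]
    by (simp add: quad_form_def power2_eq_square)
  also have "(\<Sum>j\<in>J. P k j * y * x j) = y * s"
    by (simp add: s_def sum_distrib_left mult_ac)
  also have "(\<Sum>i\<in>J. P i k * x i * y + (\<Sum>j\<in>J. P i j * x i * x j)) = y * s + quad_form J P x"
    using sym[of _ k] by (simp add: s_def sum_distrib_left sum.distrib quad_form_def mult_ac)
  also have "quad_form J P x = quad_form J (schur k P) x + s\<^sup>2 / P k k"
  proof -
    have "s\<^sup>2 / P k k = (\<Sum>i\<in>J. \<Sum>j\<in>J. P i k * P k j / P k k * x i * x j)"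
      unfolding s_def power2_eq_square sum_product sum_divide_distrib
    proof (intro sum.cong refl)
      show "P k i * x i * (P k j * x j) / P k k = P i k * P k j / P k k * x i * x j" for i j
        using sym[of i k] by simp
    qed
    then show ?thesis
      by (simp add: quad_form_def schur_def sum.distrib[symmetric] left_diff_distrib)
  qed
  also have "P k k * y\<^sup>2 + y * s + (y * s + (quad_form J (schur k P) x + s\<^sup>2 / P k k))
      = quad_form J (schur k P) x + P k k * (y + s / P k k)\<^sup>2"
    using assms(3) by (simp add: field_simps power2_eq_square)
  finally show ?thesis by (simp only: s_def)
qed

text \<open>Up to the constant on the right, the integrand is the normal density with mean
  \<open>- t\<close> and variance \<open>1 / c\<close>.\<close>

lemma nn_integral_gaussian_1:
  assumes "c > 0"
  shows "(\<integral>\<^sup>+y. ennreal (exp (- (c * (y + t)\<^sup>2) / 2)) \<partial>lborel) = ennreal (sqrt (2 * pi / c))"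
proof -
  have eq: "exp (- (c * (y + t)\<^sup>2) / 2) = sqrt (2 * pi / c) * normal_density (- t) (1 / sqrt c) y" for y
    using assms by (simp add: normal_density_def real_sqrt_divide field_simps)
  have "(\<integral>\<^sup>+y. ennreal (normal_density (- t) (1 / sqrt c) y) \<partial>lborel) = 1"
    using assms by (subst nn_integral_eq_integral) auto
  then show ?thesis
    unfolding eq using assms by (simp add: ennreal_mult nn_integral_cmult)
qed

text \<open>Integrating out one variable completes the square and replaces the matrix by its Schur
  complement.\<close>

lemma nn_integral_gaussian_PiM:
  fixes P :: "'n::finite \<Rightarrow> 'n \<Rightarrow> real"
  assumes "\<And>i j. P i j = P j i"
    and "\<And>x. \<exists>i\<in>J. x i \<noteq> 0 \<Longrightarrow> quad_form J P x > 0"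
  shows "det (restrict_matrix J P) > 0 \<and>
    (\<integral>\<^sup>+x. ennreal (exp (- quad_form J P x / 2)) \<partial>PiM J (\<lambda>_. lborel))
      = ennreal (sqrt ((2 * pi) ^ card J / det (restrict_matrix J P)))"
proof -
  interpret product_sigma_finite "\<lambda>_::'n. lborel :: real measure" ..
  have "finite J" by simp
  then show ?thesis using assms
  proof (induction J arbitrary: P rule: finite_induct)
    case empty
    have "restrict_matrix {} P = mat 1"
      by (simp add: restrict_matrix_def mat_def)
    then show ?case
      by (simp add: quad_form_def det_I nn_integral_count_space_finite PiM_empty)
  next
    case (insert k J)
    have Pkk: "P k k > 0"
    proof -
      have "quad_form (insert k J) P (\<lambda>i. if i = k then 1 else 0) = P k k"
        using insert.hyps by (simp add: quad_form_def sum.neutral if_distrib cong: if_cong)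
      then show ?thesis
        using insert.prems(2)[of "\<lambda>i. if i = k then 1 else 0"] by auto
    qed
    have sq: "quad_form (insert k J) P (x(k := y))
      = quad_form J (schur k P) x + P k k * (y + (\<Sum>j\<in>J. P k j * x j) / P k k)\<^sup>2" for x y
      using insert.hyps insert.prems(1) Pkk by (intro quad_form_insert) auto
    have sym: "schur k P i j = schur k P j i" for i j
      using insert.prems(1)[of i j] insert.prems(1)[of i k] insert.prems(1)[of j k]
      by (simp add: schur_def)
    have pos: "quad_form J (schur k P) x > 0" if "\<exists>i\<in>J. x i \<noteq> 0" for x
    proof -
      \<comment> \<open>This value of the eliminated variable makes the completed square vanish, so
        positivity passes to the Schur complement.\<close>
      have "quad_form (insert k J) P (x(k := - (\<Sum>j\<in>J. P k j * x j) / P k k)) > 0"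
        using that insert.hyps(2) by (intro insert.prems(2)) auto
      then show ?thesis using sq[of x] Pkk by simp
    qed
    note IH = insert.IH[OF sym pos]
    define I where "I = det (restrict_matrix J (schur k P))"
    have "(\<integral>\<^sup>+x. ennreal (exp (- quad_form (insert k J) P x / 2)) \<partial>PiM (insert k J) (\<lambda>_. lborel))
      = (\<integral>\<^sup>+x. (\<integral>\<^sup>+y. ennreal (exp (- quad_form (insert k J) P (x(k := y)) / 2)) \<partial>lborel)
          \<partial>PiM J (\<lambda>_. lborel))"
      using insert.hyps by (intro product_nn_integral_insert) (auto simp: quad_form_def)
    also have "\<dots> = (\<integral>\<^sup>+x. ennreal (exp (- quad_form J (schur k P) x / 2)) * ennreal (sqrt (2 * pi / P k k))
          \<partial>PiM J (\<lambda>_. lborel))"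
    proof (intro nn_integral_cong)
      fix x
      have "(\<integral>\<^sup>+y. ennreal (exp (- quad_form (insert k J) P (x(k := y)) / 2)) \<partial>lborel)
        = (\<integral>\<^sup>+y. ennreal (exp (- quad_form J (schur k P) x / 2))
            * ennreal (exp (- (P k k * (y + (\<Sum>j\<in>J. P k j * x j) / P k k)\<^sup>2) / 2)) \<partial>lborel)"
        using Pkk by (simp add: sq ennreal_mult[symmetric] exp_add[symmetric] add_divide_distrib
            diff_divide_distrib)
      also have "\<dots> = ennreal (exp (- quad_form J (schur k P) x / 2)) * ennreal (sqrt (2 * pi / P k k))"
        by (subst nn_integral_cmult) (simp, simp only: nn_integral_gaussian_1[OF Pkk])
      finally show "(\<integral>\<^sup>+y. ennreal (exp (- quad_form (insert k J) P (x(k := y)) / 2)) \<partial>lborel)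
        = ennreal (exp (- quad_form J (schur k P) x / 2)) * ennreal (sqrt (2 * pi / P k k))" .
    qed
    also have "\<dots> = ennreal (sqrt ((2 * pi) ^ card J / I)) * ennreal (sqrt (2 * pi / P k k))"
      using IH by (subst nn_integral_multc) (auto simp: quad_form_def I_def)
    also have "\<dots> = ennreal (sqrt ((2 * pi) ^ card (insert k J) / (P k k * I)))"
      using IH Pkk insert.hyps
      by (simp add: ennreal_mult[symmetric] real_sqrt_mult[symmetric] I_def mult_ac)
    finally show ?case
      using IH Pkk det_restrict_matrix_insert[of k J P] insert.hyps by (simp add: I_def)
  qed
qed

text \<open>Lebesgue measure is determined by its values on boxes, and the preimage of a box is a
  product of intervals.\<close>

lemma lborel_eq_distr_vec_lambda:
  "(lborel :: (real^'n) measure) = distr (PiM UNIV (\<lambda>_. lborel)) borel vec_lambda"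
proof (rule lborel_eqI)
  interpret product_sigma_finite "\<lambda>_::'n. lborel :: real measure" ..
  have meas: "vec_lambda \<in> PiM UNIV (\<lambda>_. lborel) \<rightarrow>\<^sub>M (borel :: (real^'n) measure)"
    by (rule borel_measurable_euclidean_space[THEN iffD2]) (auto simp: Basis_vec_def inner_axis)
  fix l u :: "real^'n" assume le: "\<And>b. b \<in> Basis \<Longrightarrow> l \<bullet> b \<le> u \<bullet> b"
  have le': "l $ i \<le> u $ i" for i
    using le[of "axis i 1"] by (auto simp: inner_axis Basis_vec_def)
  have "vec_lambda -` box l u \<inter> space (PiM UNIV (\<lambda>_. lborel)) = (\<Pi>\<^sub>E i\<in>UNIV. {l $ i<..<u $ i})"
    by (auto simp: space_PiM mem_box_cart PiE_UNIV_domain Pi_iff)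
  then have "emeasure (distr (PiM UNIV (\<lambda>_. lborel)) borel vec_lambda) (box l u)
      = (\<Prod>i\<in>UNIV. ennreal (u $ i - l $ i))"
    using le' by (simp add: emeasure_distr[OF meas] emeasure_PiM)
  also have "\<dots> = ennreal (\<Prod>i\<in>UNIV. u $ i - l $ i)"
    using le' by (intro prod_ennreal) auto
  also have "(\<Prod>i\<in>UNIV. u $ i - l $ i) = (\<Prod>b\<in>Basis. (u - l) \<bullet> b)"
  proof -
    have B: "Basis = (\<lambda>i. axis i 1 :: real^'n) ` UNIV" by (auto simp: Basis_vec_def)
    have "inj (\<lambda>i. axis i 1 :: real^'n)" by (simp add: inj_on_def axis_eq_axis)
    then show ?thesis
      unfolding B by (subst prod.reindex) (auto simp: inner_axis)
  qed
  finally show "emeasure (distr (PiM UNIV (\<lambda>_. lborel)) borel vec_lambda) (box l u)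
    = (\<Prod>b\<in>Basis. (u - l) \<bullet> b)" by (simp add: prod_ennreal)
qed simp

text \<open>The case \<open>J = UNIV\<close> of the product computation, transported along
  \<open>vec_lambda\<close>.\<close>

lemma nn_integral_gaussian_vec:
  fixes A :: "real^'n^'n"
  assumes sym: "transpose A = A" and pos: "\<And>x. x \<noteq> 0 \<Longrightarrow> x \<bullet> (A *v x) > 0"
  shows "det A > 0" and "(\<integral>\<^sup>+x. ennreal (exp (- (x \<bullet> (A *v x)) / 2)) \<partial>lborel)
      = ennreal (sqrt ((2 * pi) ^ CARD('n) / det A))"
proof -
  have q: "quad_form UNIV (\<lambda>i j. A $ i $ j) x = (\<chi> i. x i) \<bullet> (A *v (\<chi> i. x i))" for x
    by (simp add: quad_form_def inner_vec_def matrix_vector_mult_def sum_distrib_left mult_ac)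
  have r: "restrict_matrix UNIV (\<lambda>i j. A $ i $ j) = A"
    by (simp add: restrict_matrix_def vec_eq_iff)
  have meas: "vec_lambda \<in> PiM UNIV (\<lambda>_. lborel) \<rightarrow>\<^sub>M (borel :: (real^'n) measure)"
    by (rule borel_measurable_euclidean_space[THEN iffD2]) (auto simp: Basis_vec_def inner_axis)
  have m2: "(\<lambda>x. exp (- (x \<bullet> (A *v x)) / 2)) \<in> borel_measurable borel"
    by (intro borel_measurable_continuous_onI continuous_intros) auto
  have *: "det (restrict_matrix UNIV (\<lambda>i j. A $ i $ j)) > 0 \<and>
    (\<integral>\<^sup>+x. ennreal (exp (- quad_form UNIV (\<lambda>i j. A $ i $ j) x / 2)) \<partial>PiM UNIV (\<lambda>_. lborel))
      = ennreal (sqrt ((2 * pi) ^ CARD('n) / det (restrict_matrix UNIV (\<lambda>i j. A $ i $ j))))"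
  proof (rule nn_integral_gaussian_PiM)
    show "A $ i $ j = A $ j $ i" for i j
      using arg_cong[OF sym, of "\<lambda>B. B $ j $ i"] by (simp add: transpose_def)
    show "quad_form UNIV (\<lambda>i j. A $ i $ j) x > 0" if "\<exists>i\<in>UNIV. x i \<noteq> 0" for x
      unfolding q using that by (intro pos) (auto simp: vec_eq_iff)
  qed
  then show "det A > 0" by (simp add: r)
  have "(\<integral>\<^sup>+x. ennreal (exp (- (x \<bullet> (A *v x)) / 2)) \<partial>lborel)
      = (\<integral>\<^sup>+x. ennreal (exp (- quad_form UNIV (\<lambda>i j. A $ i $ j) x / 2)) \<partial>PiM UNIV (\<lambda>_. lborel))"
    unfolding q by (subst lborel_eq_distr_vec_lambda, rule nn_integral_distr[OF meas]) (use m2 in simp)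
  then show "(\<integral>\<^sup>+x. ennreal (exp (- (x \<bullet> (A *v x)) / 2)) \<partial>lborel)
      = ennreal (sqrt ((2 * pi) ^ CARD('n) / det A))"
    using * by (simp add: r)
qed

section \<open>The multivariate normal distribution\<close>

lemma sym_pos_defI_coercive:
  assumes "transpose S = S" "l > 0" "\<And>x. l * (norm x)\<^sup>2 \<le> x \<bullet> (S *v x)"
  shows "sym_pos_def S"
  unfolding sym_pos_def_def
proof (intro conjI allI impI)
  fix x :: "real^'a" assume "x \<noteq> 0"
  then have "0 < l * (norm x)\<^sup>2" using assms(2) by simp
  then show "x \<bullet> (S *v x) > 0" using assms(3)[of x] by linarith
qed (fact assms(1))

text \<open>Positivity makes the matrix injective, hence invertible. The form of the inverse at
  \<open>x\<close> is the form of \<open>S\<close> at \<open>matrix_inv S *v x\<close>, which gives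
  its positivity.\<close>

lemma sym_pos_def_inv:
  fixes S :: "real^'d^'d"
  assumes "sym_pos_def S"
  shows "S ** matrix_inv S = mat 1" "matrix_inv S ** S = mat 1" "sym_pos_def (matrix_inv S)"
proof -
  have sym: "transpose S = S" and pos: "\<And>x. x \<noteq> 0 \<Longrightarrow> x \<bullet> (S *v x) > 0"
    using assms by (auto simp: sym_pos_def_def)
  have "inj ((*v) S)"
  proof (rule injI)
    fix x y assume "S *v x = S *v y"
    then have "(x - y) \<bullet> (S *v (x - y)) = 0"
      by (simp add: matrix_vector_mult_diff_distrib)
    then show "x = y" using pos[of "x - y"] by force
  qed
  then have "invertible S"
    using invertible_left_inverse matrix_left_invertible_injective by blast
  then have "S ** matrix_inv S = mat 1 \<and> matrix_inv S ** S = mat 1"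
    unfolding invertible_def matrix_inv_def by (rule someI_ex)
  then show I: "S ** matrix_inv S = mat 1" "matrix_inv S ** S = mat 1" by auto
  have "transpose (matrix_inv S) = transpose (matrix_inv S) ** (S ** matrix_inv S)"
    by (simp add: I)
  also have "\<dots> = transpose (S ** matrix_inv S) ** matrix_inv S"
    by (simp add: matrix_transpose_mul matrix_mul_assoc sym)
  finally have "transpose (matrix_inv S) = matrix_inv S"
    by (simp add: I)
  moreover have "x \<bullet> (matrix_inv S *v x) > 0" if "x \<noteq> 0" for x
  proof -
    have x: "S *v (matrix_inv S *v x) = x"
      by (simp add: matrix_vector_mul_assoc I)
    then have "matrix_inv S *v x \<noteq> 0" using that by (metis matrix_vector_mult_0_right)
    from pos[OF this] show ?thesis by (simp add: x inner_commute)
  qed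
  ultimately show "sym_pos_def (matrix_inv S)" by (simp add: sym_pos_def_def)
qed

section \<open>Measurability and normalisation of the density\<close>

lemma borel_measurable_multi_normal_density [measurable]:
  "multi_normal_density \<mu> S \<in> borel_measurable borel"
proof -
  have "continuous_on UNIV (\<lambda>x. (x - \<mu>) \<bullet> (matrix_inv S *v (x - \<mu>)))"
    by (intro continuous_intros continuous_on_compose2[OF matrix_vector_mult_linear_continuous_on]) auto
  then have [measurable]: "(\<lambda>x. (x - \<mu>) \<bullet> (matrix_inv S *v (x - \<mu>))) \<in> borel_measurable borel"
    by (rule borel_measurable_continuous_onI)
  show ?thesis
    unfolding multi_normal_density_def[abs_def] by measurable
qed

lemma space_multi_normal [simp]: "space (multi_normal \<mu> S) = UNIV"
  and sets_multi_normal [measurable_cong, simp]: "sets (multi_normal \<mu> S) = sets borel"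
  by (simp_all add: multi_normal_def)

lemma emeasure_multi_normal:
  "E \<in> sets borel \<Longrightarrow> emeasure (multi_normal \<mu> S) E
    = (\<integral>\<^sup>+x. ennreal (multi_normal_density \<mu> S x) * indicator E x \<partial>lborel)"
  unfolding multi_normal_def by (subst emeasure_density) auto

lemma sym_pos_def_det_pos:
  fixes S :: "real^'d^'d"
  assumes "sym_pos_def S"
  shows "det S > 0"
  using assms nn_integral_gaussian_vec(1)[of S] by (auto simp: sym_pos_def_def)

text \<open>After translation by the mean this is the Gaussian integral for
  \<open>matrix_inv S\<close>, whose determinant is \<open>1 / det S\<close>; its value cancels the
  normalising constant \<open>Z\<close>.\<close>

lemma prob_space_multi_normal:
  fixes S :: "real^'d^'d"
  assumes "sym_pos_def S"
  shows "prob_space (multi_normal \<mu> S)"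
proof
  define Z where "Z = sqrt ((2 * pi) ^ CARD('d) * det S)"
  have "det S * det (matrix_inv S) = 1"
    using sym_pos_def_inv(1)[OF assms] by (metis det_I det_mul)
  then have det_inv: "det (matrix_inv S) = 1 / det S"
    using sym_pos_def_det_pos[OF assms] by (simp add: field_simps)
  have Z: "Z > 0" using sym_pos_def_det_pos[OF assms] by (simp add: Z_def)
  have dens: "ennreal (multi_normal_density \<mu> S (\<mu> + x))
      = ennreal (1 / Z) * ennreal (exp (- (x \<bullet> (matrix_inv S *v x)) / 2))" for x
    using Z by (simp add: multi_normal_density_def Z_def ennreal_mult[symmetric])
  have "(\<integral>\<^sup>+x. ennreal (multi_normal_density \<mu> S x) \<partial>lborel)
      = (\<integral>\<^sup>+x. ennreal (multi_normal_density \<mu> S x) \<partial>distr lborel borel ((+) \<mu>))"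
    by (simp add: lborel_distr_plus)
  also have "\<dots> = (\<integral>\<^sup>+x. ennreal (multi_normal_density \<mu> S (\<mu> + x)) \<partial>lborel)"
    by (rule nn_integral_distr) measurable
  also have "\<dots> = (\<integral>\<^sup>+x. ennreal (1 / Z) * ennreal (exp (- (x \<bullet> (matrix_inv S *v x)) / 2)) \<partial>lborel)"
    by (simp only: dens)
  also have "\<dots> = ennreal (1 / Z) * (\<integral>\<^sup>+x. ennreal (exp (- (x \<bullet> (matrix_inv S *v x)) / 2)) \<partial>lborel)"
  proof (rule nn_integral_cmult)
    have "continuous_on UNIV (\<lambda>x. exp (- (x \<bullet> (matrix_inv S *v x)) / 2))"
      by (intro continuous_intros) auto
    from borel_measurable_continuous_onI[OF this]
    show "(\<lambda>x. ennreal (exp (- (x \<bullet> (matrix_inv S *v x)) / 2))) \<in> borel_measurable lborel" by simp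
  qed
  also have "\<dots> = ennreal (1 / Z) * ennreal Z"
    using sym_pos_def_inv(3)[OF assms]
    by (subst nn_integral_gaussian_vec(2)) (auto simp: sym_pos_def_def det_inv Z_def)
  also have "\<dots> = 1"
    using Z by (simp add: ennreal_mult[symmetric])
  finally show "emeasure (multi_normal \<mu> S) (space (multi_normal \<mu> S)) = 1"
    by (simp add: emeasure_multi_normal)
qed

text \<open>The point reflection at the mean preserves Lebesgue measure, and the density is even
  about the mean.\<close>

lemma multi_normal_reflect:
  fixes S :: "real^'d^'d"
  assumes "E \<in> sets borel" and \<tau>: "\<tau> = 2 *\<^sub>R \<mu>"
  shows "emeasure (multi_normal \<mu> S) E = emeasure (multi_normal \<mu> S) ((\<lambda>x. \<tau> - x) -` E)"
proof -
  have [measurable]: "E \<in> sets borel" by fact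
  \<comment> \<open>The reflection is written as an affine map with factor -1, the form to which the
    change of variables \<open>lborel_affine\<close> applies.\<close>
  have meas: "(\<lambda>x::real^'d. \<tau> + (-1) *\<^sub>R x) \<in> lborel \<rightarrow>\<^sub>M borel" by simp
  have pre: "(\<lambda>x. \<tau> - x) -` E \<in> sets borel"
    using measurable_sets[OF meas assms(1)] by simp
  have dens: "multi_normal_density \<mu> S (\<tau> - x) = multi_normal_density \<mu> S x" for x
  proof -
    have "\<tau> - x - \<mu> = - (x - \<mu>)"
      unfolding \<tau> scaleR_2 by (simp only: algebra_simps) simp
    moreover have "matrix_inv S *v (- (x - \<mu>)) = - (matrix_inv S *v (x - \<mu>))"
      using matrix_vector_mult_diff_distrib[of "matrix_inv S" 0 "x - \<mu>"] by simp
    ultimately show ?thesis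
      unfolding multi_normal_density_def by (simp only: inner_minus_left inner_minus_right minus_minus)
  qed
  have "emeasure (multi_normal \<mu> S) E
      = (\<integral>\<^sup>+x. ennreal (multi_normal_density \<mu> S x) * indicator E x \<partial>lborel)"
    by (rule emeasure_multi_normal[OF assms(1)])
  also have "\<dots> = (\<integral>\<^sup>+x. ennreal (multi_normal_density \<mu> S x) * indicator E x
      \<partial>distr lborel borel (\<lambda>x. \<tau> + (-1) *\<^sub>R x))"
    using lborel_affine[of "-1" \<tau>] by (simp add: density_1)
  also have "\<dots> = (\<integral>\<^sup>+x. ennreal (multi_normal_density \<mu> S x)
      * indicator ((\<lambda>x. \<tau> - x) -` E) x \<partial>lborel)"
    by (subst nn_integral_distr[OF meas]) (auto simp: dens indicator_def)
  also have "\<dots> = emeasure (multi_normal \<mu> S) ((\<lambda>x. \<tau> - x) -` E)"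
    by (rule emeasure_multi_normal[OF pre, symmetric])
  finally show ?thesis .
qed

text \<open>The two closed half-spaces bounded by a hyperplane through the mean are mirror images of
  each other and cover the space. For \<open>\<theta> = 0\<close> both are the whole space.\<close>

lemma multi_normal_halfspace_ge_half:
  fixes S :: "real^'d^'d"
  assumes "sym_pos_def S"
  shows "measure (multi_normal \<mu> S) {x. \<theta> \<bullet> (x - \<mu>) \<ge> 0} \<ge> 1 / 2"
proof -
  interpret prob_space "multi_normal \<mu> S" by (rule prob_space_multi_normal[OF assms])
  have [measurable]: "{x. \<theta> \<bullet> (x - \<mu>) \<ge> 0} \<in> sets borel" "{x. \<theta> \<bullet> (x - \<mu>) \<le> 0} \<in> sets borel"
    by measurable
  define \<tau> where "\<tau> = 2 *\<^sub>R \<mu>"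
  have "\<theta> \<bullet> \<tau> = 2 * (\<theta> \<bullet> \<mu>)" by (simp only: \<tau>_def inner_scaleR_right)
  then have "(\<lambda>x. \<tau> - x) -` {x. \<theta> \<bullet> (x - \<mu>) \<ge> 0} = {x. \<theta> \<bullet> (x - \<mu>) \<le> 0}"
    by (auto simp: inner_diff_right inner_add_right)
  then have eq: "prob {x. \<theta> \<bullet> (x - \<mu>) \<ge> 0} = prob {x. \<theta> \<bullet> (x - \<mu>) \<le> 0}"
    using multi_normal_reflect[of "{x. \<theta> \<bullet> (x - \<mu>) \<ge> 0}" \<tau> \<mu> S] \<tau>_def
    by (simp add: measure_def)
  have "1 = prob ({x. \<theta> \<bullet> (x - \<mu>) \<ge> 0} \<union> {x. \<theta> \<bullet> (x - \<mu>) \<le> 0})"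
    using prob_space by (simp add: Collect_disj_eq[symmetric] linorder_linear)
  also have "\<dots> \<le> prob {x. \<theta> \<bullet> (x - \<mu>) \<ge> 0} + prob {x. \<theta> \<bullet> (x - \<mu>) \<le> 0}"
    by (intro measure_Un_le) auto
  finally show ?thesis using eq by simp
qed

text \<open>All these balls lie within distance \<open>R + r\<close> of the mean, where the density
  has the positive lower bound \<open>m\<close>. Mass at least \<open>m\<close> times the volume of
  the ball follows, whatever the centre.\<close>

lemma multi_normal_ball_ge:
  fixes S :: "real^'d^'d"
  assumes S: "sym_pos_def S" and "r > 0"
  shows "\<exists>\<delta>>0. \<forall>c. norm (c - \<mu>) \<le> R \<longrightarrow> measure (multi_normal \<mu> S) (ball c r) \<ge> \<delta>"
proof -
  interpret prob_space "multi_normal \<mu> S" by (rule prob_space_multi_normal[OF S])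
  obtain K where "K > 0" and K: "\<And>x. norm (matrix_inv S *v x) \<le> norm x * K"
    using bounded_linear.pos_bounded[OF matrix_vector_mul_bounded_linear] by blast
  define m where "m = exp (- ((R + r)\<^sup>2 * K) / 2) / sqrt ((2 * pi) ^ CARD('d) * det S)"
  have "m > 0" using sym_pos_def_det_pos[OF S] by (simp add: m_def)
  define V where "V = measure lborel (ball (0::real^'d) r)"
  have "V > 0" using \<open>r > 0\<close> by (simp add: V_def)
  have "m * V \<le> prob (ball c r)" if c: "norm (c - \<mu>) \<le> R" for c
  proof -
    have lower: "m \<le> multi_normal_density \<mu> S x" if "x \<in> ball c r" for x
    proof -
      have "norm (x - \<mu>) \<le> norm (x - c) + norm (c - \<mu>)"
        by (metis diff_add_cancel add_diff_eq norm_triangle_ineq)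
      then have "norm (x - \<mu>) \<le> R + r"
        using that c by (simp add: dist_norm norm_minus_commute)
      then have "(norm (x - \<mu>))\<^sup>2 * K \<le> (R + r)\<^sup>2 * K"
        using \<open>K > 0\<close> by (intro mult_right_mono power_mono) auto
      moreover have "(x - \<mu>) \<bullet> (matrix_inv S *v (x - \<mu>)) \<le> norm (x - \<mu>) * (norm (x - \<mu>) * K)"
        by (rule order_trans[OF norm_cauchy_schwarz]) (intro mult_left_mono K norm_ge_zero)
      ultimately show ?thesis
        using sym_pos_def_det_pos[OF S] unfolding m_def multi_normal_density_def
        by (intro divide_right_mono) (auto simp: power2_eq_square mult_ac)
    qed
    have "emeasure lborel (ball c r) = ennreal V"
      using \<open>r > 0\<close> by (simp add: V_def content_ball emeasure_ball)
    then have "ennreal (m * V) = (\<integral>\<^sup>+x. ennreal m * indicator (ball c r) x \<partial>lborel)"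
      using \<open>m > 0\<close> \<open>V > 0\<close> by (simp add: nn_integral_cmult_indicator ennreal_mult)
    also have "\<dots> \<le> (\<integral>\<^sup>+x. ennreal (multi_normal_density \<mu> S x) * indicator (ball c r) x \<partial>lborel)"
      using lower by (intro nn_integral_mono) (auto simp: indicator_def ennreal_leI)
    also have "\<dots> = emeasure (multi_normal \<mu> S) (ball c r)"
      by (simp add: emeasure_multi_normal)
    also have "\<dots> = ennreal (prob (ball c r))"
      by (rule emeasure_eq_measure)
    finally show ?thesis by (simp add: ennreal_le_iff)
  qed
  then show ?thesis using \<open>m > 0\<close> \<open>V > 0\<close> by (intro exI[of _ "m * V"]) auto
qed

text \<open>The gain over \<open>1/2\<close> comes from a ball of fixed radius inside the strip between the hyperplane
  through the mean and the decision hyperplane.\<close>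

lemma multi_normal_halfspace_gt_half:
  fixes S :: "real^'d^'d"
  assumes S: "sym_pos_def S" and "e > 0"
  shows "\<exists>\<delta>>0. \<forall>\<theta>. norm \<theta> \<le> M \<and> \<theta> \<bullet> \<mu> \<ge> e
    \<longrightarrow> measure (multi_normal \<mu> S) {x. \<theta> \<bullet> x > 0} \<ge> 1 / 2 + \<delta>"
proof -
  interpret prob_space "multi_normal \<mu> S" by (rule prob_space_multi_normal[OF S])
  \<comment> \<open>Chosen so that \<open>norm \<theta> \<le> M\<close> gives
    \<open>norm \<theta> * r < e / 2\<close>, half the width of the strip measured by
    \<open>\<theta> \<bullet> x\<close>. The \<open>+ 1\<close> keeps the denominator
    positive.\<close>
  define r where "r = e / (2 * (\<bar>M\<bar> + 1))"
  have "r > 0" using \<open>e > 0\<close> by (simp add: r_def)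
  obtain \<delta> where "\<delta> > 0" and \<delta>: "\<And>c. norm (c - \<mu>) \<le> norm \<mu> \<Longrightarrow> prob (ball c r) \<ge> \<delta>"
    using multi_normal_ball_ge[OF S \<open>r > 0\<close>] by blast
  have "1 / 2 + \<delta> \<le> prob {x. \<theta> \<bullet> x > 0}" if \<theta>: "norm \<theta> \<le> M" "\<theta> \<bullet> \<mu> \<ge> e" for \<theta>
  proof -
    have "\<theta> \<noteq> 0" using \<theta>(2) \<open>e > 0\<close> by auto
    \<comment> \<open>The point with \<open>\<theta> \<bullet> (c - \<mu>) = - e / 2\<close>, in the
      middle of the strip. By Cauchy-Schwarz its distance \<open>e / (2 * norm \<theta>)\<close>
      from the mean is at most \<open>norm \<mu>\<close>, hence that radius in the choice of
      \<open>\<delta>\<close>.\<close>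
    define c where "c = \<mu> - (e / (2 * (norm \<theta>)\<^sup>2)) *\<^sub>R \<theta>"
    have "e \<le> norm \<theta> * norm \<mu>"
      using norm_cauchy_schwarz[of \<theta> \<mu>] \<theta>(2) by linarith
    then have "e / (2 * norm \<theta>) \<le> norm \<mu>"
      using \<open>\<theta> \<noteq> 0\<close> \<open>e > 0\<close> by (simp add: field_simps)
    moreover have "norm (c - \<mu>) = e / (2 * norm \<theta>)"
      using \<open>\<theta> \<noteq> 0\<close> \<open>e > 0\<close> by (simp add: c_def power2_eq_square field_simps)
    ultimately have ball: "prob (ball c r) \<ge> \<delta>" using \<delta> by simp
    have strip: "- e < \<theta> \<bullet> (x - \<mu>) \<and> \<theta> \<bullet> (x - \<mu>) < 0" if "x \<in> ball c r" for x
    proof -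
      have "\<bar>\<theta> \<bullet> (x - c)\<bar> \<le> norm \<theta> * norm (x - c)"
        by (rule Cauchy_Schwarz_ineq2)
      also have "\<dots> \<le> norm \<theta> * r"
        using that by (intro mult_left_mono) (auto simp: dist_norm norm_minus_commute)
      also have "\<dots> \<le> \<bar>M\<bar> * r"
        using \<theta>(1) \<open>r > 0\<close> by (intro mult_right_mono) auto
      also have "\<dots> < e / 2"
        using \<open>e > 0\<close> by (simp add: r_def field_simps)
      finally have "\<bar>\<theta> \<bullet> (x - c)\<bar> < e / 2" .
      moreover have "\<theta> \<bullet> (x - \<mu>) = \<theta> \<bullet> (x - c) - e / 2"
        using \<open>\<theta> \<noteq> 0\<close> by (simp add: c_def inner_diff_right power2_norm_eq_inner)
      ultimately show ?thesis by (auto simp: abs_less_iff)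
    qed
    have [measurable]: "{x. \<theta> \<bullet> (x - \<mu>) \<ge> 0} \<in> sets borel" "{x. \<theta> \<bullet> x > 0} \<in> sets borel"
      by measurable
    have "1 / 2 + \<delta> \<le> prob {x. \<theta> \<bullet> (x - \<mu>) \<ge> 0} + prob (ball c r)"
      using ball multi_normal_halfspace_ge_half[OF S, of \<mu> \<theta>] by linarith
    also have "\<dots> = prob ({x. \<theta> \<bullet> (x - \<mu>) \<ge> 0} \<union> ball c r)"
    proof (rule finite_measure_Union[symmetric])
      show "{x. \<theta> \<bullet> (x - \<mu>) \<ge> 0} \<inter> ball c r = {}" using strip by fastforce
    qed simp_all
    also have "\<dots> \<le> prob {x. \<theta> \<bullet> x > 0}"
    proof (rule finite_measure_mono)
      show "{x. \<theta> \<bullet> (x - \<mu>) \<ge> 0} \<union> ball c r \<subseteq> {x. \<theta> \<bullet> x > 0}"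
      proof
        fix x assume "x \<in> {x. \<theta> \<bullet> (x - \<mu>) \<ge> 0} \<union> ball c r"
        then have "- e < \<theta> \<bullet> (x - \<mu>)" using strip[of x] \<open>e > 0\<close> by auto
        then show "x \<in> {x. \<theta> \<bullet> x > 0}" using \<theta>(2) by (simp add: inner_diff_right)
      qed
    qed simp
    finally show ?thesis .
  qed
  then show ?thesis using \<open>\<delta> > 0\<close> by blast
qed

text \<open>Ties count as correct for this class, so the event contains the open half-space.\<close>

lemma phat\<^sub>1_gt_half:
  assumes S: "sym_pos_def S" and "e > 0"
  shows "\<exists>\<delta>>0. \<forall>\<theta>. norm \<theta> \<le> M \<and> \<mu> \<bullet> \<theta> \<ge> e \<longrightarrow> phat\<^sub>1 \<mu> S \<theta> \<ge> 1 / 2 + \<delta>"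
proof -
  interpret prob_space "multi_normal \<mu> S" by (rule prob_space_multi_normal[OF S])
  obtain \<delta> where "\<delta> > 0" and \<delta>: "\<And>\<theta>. norm \<theta> \<le> M \<and> \<theta> \<bullet> \<mu> \<ge> e
      \<Longrightarrow> prob {x. \<theta> \<bullet> x > 0} \<ge> 1 / 2 + \<delta>"
    using multi_normal_halfspace_gt_half[OF assms] by blast
  have "phat\<^sub>1 \<mu> S \<theta> \<ge> 1 / 2 + \<delta>" if "norm \<theta> \<le> M \<and> \<mu> \<bullet> \<theta> \<ge> e" for \<theta>
  proof -
    have "1 / 2 + \<delta> \<le> prob {x. \<theta> \<bullet> x > 0}"
      using that by (intro \<delta>) (simp add: inner_commute)
    also have "\<dots> \<le> prob {x. \<theta> \<bullet> x \<ge> 0}"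
      by (intro finite_measure_mono) auto
    finally show ?thesis by (simp add: phat\<^sub>1_def)
  qed
  then show ?thesis using \<open>\<delta> > 0\<close> by blast
qed

text \<open>The event is the open positive half-space of the reversed classifier
  \<open>- \<theta>\<close>.\<close>

lemma phat\<^sub>m_gt_half:
  assumes S: "sym_pos_def S" and "e > 0"
  shows "\<exists>\<delta>>0. \<forall>\<theta>. norm \<theta> \<le> M \<and> - (\<mu> \<bullet> \<theta>) \<ge> e \<longrightarrow> phat\<^sub>m \<mu> S \<theta> \<ge> 1 / 2 + \<delta>"
proof -
  obtain \<delta> where "\<delta> > 0" and \<delta>: "\<And>\<theta>. norm \<theta> \<le> M \<and> \<theta> \<bullet> \<mu> \<ge> e
      \<Longrightarrow> measure (multi_normal \<mu> S) {x. \<theta> \<bullet> x > 0} \<ge> 1 / 2 + \<delta>"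
    using multi_normal_halfspace_gt_half[OF assms] by blast
  have "phat\<^sub>m \<mu> S \<theta> \<ge> 1 / 2 + \<delta>" if "norm \<theta> \<le> M \<and> - (\<mu> \<bullet> \<theta>) \<ge> e" for \<theta>
    using \<delta>[of "- \<theta>"] that by (simp add: phat\<^sub>m_def inner_commute)
  then show ?thesis using \<open>\<delta> > 0\<close> by blast
qed

section \<open>The margins of the optimal classifier\<close>

lemma outer_mult_vec: "outer v *v x = (v \<bullet> x) *\<^sub>R v"
  by (simp add: outer_def matrix_vector_mult_def inner_vec_def vec_eq_iff sum_distrib_left mult_ac)

lemma transpose_add: "transpose (A + B) = transpose A + transpose B"
  by (simp add: transpose_def vec_eq_iff)

text \<open>The norm bound depends on the coercivity constant alone; since the regularisation
  \<open>l\<close> serves for every state, it makes later estimates uniform.\<close>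

lemma coercive_inverse:
  fixes S :: "real^'d^'d"
  assumes "transpose S = S" "l > 0" and coer: "\<And>x. l * (norm x)\<^sup>2 \<le> x \<bullet> (S *v x)"
  shows "S *v (matrix_inv S *v x) = x" "matrix_inv S *v (S *v x) = x"
    "norm (matrix_inv S *v x) \<le> norm x / l" "x \<bullet> (matrix_inv S *v y) = y \<bullet> (matrix_inv S *v x)"
    "x \<bullet> (matrix_inv S *v x) \<ge> 0"
proof -
  note spd = sym_pos_defI_coercive[OF assms]
  note I = sym_pos_def_inv[OF spd]
  show inv: "S *v (matrix_inv S *v x) = x" "matrix_inv S *v (S *v x) = x" for x
    by (simp_all add: matrix_vector_mul_assoc I)
  show "norm (matrix_inv S *v x) \<le> norm x / l"
  proof (cases "matrix_inv S *v x = 0")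
    case False
    let ?y = "matrix_inv S *v x"
    have "l * (norm ?y)\<^sup>2 \<le> ?y \<bullet> x" using coer[of ?y] by (simp add: inv)
    also have "\<dots> \<le> norm ?y * norm x" by (rule norm_cauchy_schwarz)
    finally have "norm ?y * (l * norm ?y) \<le> norm ?y * norm x"
      by (simp add: power2_eq_square mult_ac)
    then have "l * norm ?y \<le> norm x" using False by simp
    then show ?thesis using assms(2) by (simp add: field_simps)
  qed (use assms(2) in simp)
  have "transpose (matrix_inv S) = matrix_inv S" using I(3) by (simp add: sym_pos_def_def)
  then show "x \<bullet> (matrix_inv S *v y) = y \<bullet> (matrix_inv S *v x)"
    by (metis dot_lmul_matrix inner_commute transpose_matrix_vector)
  show "x \<bullet> (matrix_inv S *v x) \<ge> 0"
    using I(3) by (cases "x = 0") (auto simp: sym_pos_def_def intro: less_imp_le)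
qed

lemma nonneg_form_cauchy_schwarz:
  fixes g h c :: real
  assumes "\<And>x y. x\<^sup>2 * g + 2 * (x * y) * c + y\<^sup>2 * h \<ge> 0"
  shows "c\<^sup>2 \<le> g * h"
proof -
  have "0 \<le> g" using assms[of 1 0] by simp
  show ?thesis
  proof (cases "g = 0")
    case False
    \<comment> \<open>Testing the form at \<open>(- c, g)\<close> produces \<open>g\<close> times
      the determinant.\<close>
    have "0 \<le> (- c)\<^sup>2 * g + 2 * (- c * g) * c + g\<^sup>2 * h" by (rule assms)
    also have "\<dots> = g * (g * h - c\<^sup>2)" by (simp add: power2_eq_square algebra_simps)
    finally show ?thesis using False \<open>0 \<le> g\<close> by (simp add: zero_le_mult_iff)
  next
    case True
    \<comment> \<open>With \<open>g = 0\<close> the form at \<open>(- (h + 1), c)\<close> is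
      \<open>- (c\<^sup>2 * (h + 2))\<close>, which forces \<open>c = 0\<close>.\<close>
    have "0 \<le> 2 * (- (h + 1) * c) * c + c\<^sup>2 * h" using assms[of "- (h + 1)" c] True by simp
    also have "\<dots> = - (c\<^sup>2 * (h + 2))" by (simp add: power2_eq_square algebra_simps)
    finally have "c\<^sup>2 * (h + 2) \<le> 0" by simp
    moreover have "h \<ge> 0" using assms[of 0 1] by simp
    ultimately have "c\<^sup>2 \<le> 0" by (simp add: mult_le_0_iff)
    then show ?thesis using True by simp
  qed
qed

text \<open>Cramer's rule for the margins \<open>u = \<mu>\<^sub>1 \<bullet> \<theta>\<close> and \<open>v = \<mu>\<^sub>m \<bullet> \<theta>\<close>.\<close>

lemma margins_bound:
  fixes a b g h c u v G :: real
  assumes "0 \<le> a" "a \<le> 1" "0 \<le> b" "b \<le> 1" "0 \<le> g" "g \<le> G" "0 \<le> h" "h \<le> G" "c\<^sup>2 \<le> g * h"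
    and u: "u = a * (1 - u) * g - b * (1 + v) * c"
    and v: "v = a * (1 - u) * c - b * (1 + v) * h"
  shows "a * g - b * c \<le> u * (1 + a * g + b * h + a * b * (g * h - c\<^sup>2))"
    and "b * h - a * c \<le> - v * (1 + a * g + b * h + a * b * (g * h - c\<^sup>2))"
    and "1 \<le> 1 + a * g + b * h + a * b * (g * h - c\<^sup>2)"
    and "1 + a * g + b * h + a * b * (g * h - c\<^sup>2) \<le> (1 + G)\<^sup>2"
proof -
  \<comment> \<open>The determinant of the linear system for \<open>u\<close> and
    \<open>v\<close>.\<close>
  define D where "D = 1 + a * g + b * h + a * b * (g * h - c\<^sup>2)"
  have ab: "0 \<le> a * b * (g * h - c\<^sup>2)" using assms by simp
  \<comment> \<open>The summand \<open>a * b * (g * h - c\<^sup>2)\<close>, nonnegative by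
    Cauchy-Schwarz, is dropped to get the lower bounds.\<close>
  have "u * D = a * g - b * c + a * b * (g * h - c\<^sup>2)"
    using u v unfolding D_def by algebra
  then show "a * g - b * c \<le> u * (1 + a * g + b * h + a * b * (g * h - c\<^sup>2))"
    using ab by (simp add: D_def)
  have "- v * D = b * h - a * c + a * b * (g * h - c\<^sup>2)"
    using u v unfolding D_def by algebra
  then show "b * h - a * c \<le> - v * (1 + a * g + b * h + a * b * (g * h - c\<^sup>2))"
    using ab by (simp add: D_def)
  show "1 \<le> 1 + a * g + b * h + a * b * (g * h - c\<^sup>2)"
    using ab assms by simp
  have ag: "a * g \<le> G" "b * h \<le> G"
    using mult_mono[of a 1 g G] mult_mono[of b 1 h G] assms by auto
  have "D \<le> (1 + a * g) * (1 + b * h)"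
    using assms by (simp add: D_def algebra_simps)
  also have "\<dots> \<le> (1 + G) * (1 + G)"
    using ag assms by (intro mult_mono) auto
  finally show "1 + a * g + b * h + a * b * (g * h - c\<^sup>2) \<le> (1 + G)\<^sup>2"
    by (simp add: D_def power2_eq_square)
qed

text \<open>The covariance terms carry nonnegative weights and only add to the form, so the constant
  \<open>l\<close> comes from the regularisation and does not depend on
  \<open>\<alpha>\<close>.\<close>

lemma N_mat_coercive:
  fixes S\<^sub>1 S\<^sub>m :: "real^'d^'d"
  assumes "0 \<le> p" "p \<le> 1" "sym_pos_def S\<^sub>1" "sym_pos_def S\<^sub>m" "\<alpha> \<in> {0..1} \<times> {0..1}"
  shows "transpose (N_mat p l S\<^sub>1 S\<^sub>m \<alpha>) = N_mat p l S\<^sub>1 S\<^sub>m \<alpha>"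
    and "l * (norm x)\<^sup>2 \<le> x \<bullet> (N_mat p l S\<^sub>1 S\<^sub>m \<alpha> *v x)"
proof -
  have sym: "S\<^sub>1 $ j $ i = S\<^sub>1 $ i $ j" "S\<^sub>m $ j $ i = S\<^sub>m $ i $ j" for i j
    using assms(3,4) unfolding sym_pos_def_def transpose_def vec_eq_iff by auto
  show "transpose (N_mat p l S\<^sub>1 S\<^sub>m \<alpha>) = N_mat p l S\<^sub>1 S\<^sub>m \<alpha>"
    by (simp add: N_mat_def transpose_def vec_eq_iff sym mat_def)
  have nonneg: "x \<bullet> (S\<^sub>1 *v x) \<ge> 0" "x \<bullet> (S\<^sub>m *v x) \<ge> 0"
    using assms(3,4) unfolding sym_pos_def_def by (cases "x = 0"; force intro: less_imp_le)+
  have "0 \<le> p * fst \<alpha> * (x \<bullet> (S\<^sub>1 *v x))" "0 \<le> (1 - p) * snd \<alpha> * (x \<bullet> (S\<^sub>m *v x))"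
    using assms nonneg by (auto intro!: mult_nonneg_nonneg)
  then show "l * (norm x)\<^sup>2 \<le> x \<bullet> (N_mat p l S\<^sub>1 S\<^sub>m \<alpha> *v x)"
    by (simp add: N_mat_def matrix_vector_mult_add_rdistrib scaleR_matrix_vector_assoc[symmetric]
        inner_add_right power2_norm_eq_inner)
qed

section \<open>The matrix \<open>A\<close> as a rank-two perturbation of \<open>N\<close>\<close>

lemma A_mat_eq_N_mat:
  "A_mat p l \<mu>\<^sub>1 \<mu>\<^sub>m S\<^sub>1 S\<^sub>m \<alpha> = N_mat p l S\<^sub>1 S\<^sub>m \<alpha> + (p * fst \<alpha>) *\<^sub>R outer \<mu>\<^sub>1
    + ((1 - p) * snd \<alpha>) *\<^sub>R outer \<mu>\<^sub>m"
  by (simp add: A_mat_def N_mat_def scaleR_right_distrib)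

lemma A_mat_mult_vec:
  "A_mat p l \<mu>\<^sub>1 \<mu>\<^sub>m S\<^sub>1 S\<^sub>m \<alpha> *v x = N_mat p l S\<^sub>1 S\<^sub>m \<alpha> *v x + (p * fst \<alpha> * (\<mu>\<^sub>1 \<bullet> x)) *\<^sub>R \<mu>\<^sub>1
    + ((1 - p) * snd \<alpha> * (\<mu>\<^sub>m \<bullet> x)) *\<^sub>R \<mu>\<^sub>m"
  by (simp add: A_mat_eq_N_mat matrix_vector_mult_add_rdistrib scaleR_matrix_vector_assoc[symmetric]
      outer_mult_vec)

lemma A_mat_coercive:
  fixes S\<^sub>1 S\<^sub>m :: "real^'d^'d"
  assumes "0 \<le> p" "p \<le> 1" "sym_pos_def S\<^sub>1" "sym_pos_def S\<^sub>m" "\<alpha> \<in> {0..1} \<times> {0..1}"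
  shows "transpose (A_mat p l \<mu>\<^sub>1 \<mu>\<^sub>m S\<^sub>1 S\<^sub>m \<alpha>) = A_mat p l \<mu>\<^sub>1 \<mu>\<^sub>m S\<^sub>1 S\<^sub>m \<alpha>"
    and "l * (norm x)\<^sup>2 \<le> x \<bullet> (A_mat p l \<mu>\<^sub>1 \<mu>\<^sub>m S\<^sub>1 S\<^sub>m \<alpha> *v x)"
proof -
  have "transpose (c *\<^sub>R outer v) = c *\<^sub>R outer v" for c and v :: "real^'d"
    by (simp add: transpose_def outer_def vec_eq_iff mult.commute)
  then show "transpose (A_mat p l \<mu>\<^sub>1 \<mu>\<^sub>m S\<^sub>1 S\<^sub>m \<alpha>) = A_mat p l \<mu>\<^sub>1 \<mu>\<^sub>m S\<^sub>1 S\<^sub>m \<alpha>"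
    by (simp add: A_mat_eq_N_mat transpose_add N_mat_coercive(1)[OF assms])
  have "0 \<le> p * fst \<alpha> * (\<mu>\<^sub>1 \<bullet> x)\<^sup>2" "0 \<le> (1 - p) * snd \<alpha> * (\<mu>\<^sub>m \<bullet> x)\<^sup>2"
    using assms by (auto intro!: mult_nonneg_nonneg)
  then show "l * (norm x)\<^sup>2 \<le> x \<bullet> (A_mat p l \<mu>\<^sub>1 \<mu>\<^sub>m S\<^sub>1 S\<^sub>m \<alpha> *v x)"
    using N_mat_coercive(2)[OF assms, of l x]
    by (simp add: A_mat_mult_vec inner_add_right power2_eq_square inner_commute mult_ac)
qed

section \<open>The walk-up rate dynamics\<close>

lemma proj_velocity_nonneg: "v \<ge> 0 \<Longrightarrow> proj_velocity a v \<ge> 0"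
  by (simp add: proj_velocity_def)

lemma proj_velocity_interior: "0 < a \<Longrightarrow> a < 1 \<Longrightarrow> proj_velocity a v = v"
  by (simp add: proj_velocity_def)

text \<open>The supremum condition enters as a pointwise bound by one fixed negative number
  \<open>s\<close>, from which bounds uniform in the state can be computed.\<close>

locale walkup =
  fixes p l s :: real and \<mu>\<^sub>1 \<mu>\<^sub>m :: "real^'d" and S\<^sub>1 S\<^sub>m :: "real^'d^'d"
  assumes p: "0 < p" "p < 1" and l: "l > 0"
    and S\<^sub>1: "sym_pos_def S\<^sub>1" and S\<^sub>m: "sym_pos_def S\<^sub>m" and s: "s < 0"
    and cross: "\<And>\<alpha>. \<alpha> \<in> {0..1} \<times> {0..1}
      \<Longrightarrow> \<mu>\<^sub>1 \<bullet> (matrix_inv (N_mat p l S\<^sub>1 S\<^sub>m \<alpha>) *v \<mu>\<^sub>m) \<le> s"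
begin

abbreviation "F \<equiv> F_cls p l \<mu>\<^sub>1 \<mu>\<^sub>m S\<^sub>1 S\<^sub>m"
abbreviation "field \<equiv> walkup_field p l \<mu>\<^sub>1 \<mu>\<^sub>m S\<^sub>1 S\<^sub>m"

text \<open>A common upper bound for the diagonal values of the form of the inverse of
  \<open>N\<close> at the two means, as that inverse has norm at most \<open>1 / l\<close>.\<close>

definition "G = ((norm \<mu>\<^sub>1)\<^sup>2 + (norm \<mu>\<^sub>m)\<^sup>2) / l"

lemma norm_F_le:
  assumes "\<alpha> \<in> {0..1} \<times> {0..1}"
  shows "norm (F \<alpha>) \<le> (norm \<mu>\<^sub>1 + norm \<mu>\<^sub>m) / l"
proof -
  have b: "p * fst \<alpha> \<le> 1" "(1 - p) * snd \<alpha> \<le> 1" "0 \<le> p * fst \<alpha>" "0 \<le> (1 - p) * snd \<alpha>"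
    using assms p by (auto intro!: mult_le_one)
  have "norm (b_vec p \<mu>\<^sub>1 \<mu>\<^sub>m \<alpha>) \<le> norm ((p * fst \<alpha>) *\<^sub>R \<mu>\<^sub>1) + norm (((1 - p) * snd \<alpha>) *\<^sub>R \<mu>\<^sub>m)"
    unfolding b_vec_def by (rule norm_triangle_ineq4)
  also have "\<dots> \<le> norm \<mu>\<^sub>1 + norm \<mu>\<^sub>m"
    unfolding norm_scaleR abs_of_nonneg[OF b(3)] abs_of_nonneg[OF b(4)]
    by (intro add_mono mult_left_le_one_le b norm_ge_zero)
  finally have "norm (b_vec p \<mu>\<^sub>1 \<mu>\<^sub>m \<alpha>) / l \<le> (norm \<mu>\<^sub>1 + norm \<mu>\<^sub>m) / l"
    using l by (intro divide_right_mono) auto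
  moreover have "norm (F \<alpha>) \<le> norm (b_vec p \<mu>\<^sub>1 \<mu>\<^sub>m \<alpha>) / l"
    unfolding F_cls_def using p l S\<^sub>1 S\<^sub>m assms
    by (intro coercive_inverse(3) A_mat_coercive) auto
  ultimately show ?thesis by linarith
qed

text \<open>The quantitative bounds come from the cross term, so each margin is controlled by the
  walk-up rate of the other class. The two positivity claims come from the diagonal terms
  \<open>a * g\<close> and \<open>b * h\<close>, and therefore survive when the rate of the other
  class is 0.\<close>

lemma margins:
  assumes \<alpha>: "\<alpha> \<in> {0..1} \<times> {0..1}"
  shows "(1 - p) * snd \<alpha> * (- s) / (1 + G)\<^sup>2 \<le> \<mu>\<^sub>1 \<bullet> F \<alpha>"
    and "p * fst \<alpha> * (- s) / (1 + G)\<^sup>2 \<le> - (\<mu>\<^sub>m \<bullet> F \<alpha>)"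
    and "fst \<alpha> > 0 \<Longrightarrow> \<mu>\<^sub>1 \<bullet> F \<alpha> > 0"
    and "snd \<alpha> > 0 \<Longrightarrow> - (\<mu>\<^sub>m \<bullet> F \<alpha>) > 0"
proof -
  define W where "W = matrix_inv (N_mat p l S\<^sub>1 S\<^sub>m \<alpha>)"
  define a where "a = p * fst \<alpha>"
  define b where "b = (1 - p) * snd \<alpha>"
  define \<theta> where "\<theta> = F \<alpha>"
  define u where "u = \<mu>\<^sub>1 \<bullet> \<theta>"
  define v where "v = \<mu>\<^sub>m \<bullet> \<theta>"
  define g where "g = \<mu>\<^sub>1 \<bullet> (W *v \<mu>\<^sub>1)"
  define h where "h = \<mu>\<^sub>m \<bullet> (W *v \<mu>\<^sub>m)"
  define c where "c = \<mu>\<^sub>1 \<bullet> (W *v \<mu>\<^sub>m)"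
  have p': "0 \<le> p" "p \<le> 1" using p by auto
  have ab: "0 \<le> a" "a \<le> 1" "0 \<le> b" "b \<le> 1"
    using \<alpha> p by (auto simp: a_def b_def intro!: mult_le_one)
  note N = coercive_inverse[OF N_mat_coercive(1)[OF p' S\<^sub>1 S\<^sub>m \<alpha>] l N_mat_coercive(2)[OF p' S\<^sub>1 S\<^sub>m \<alpha>],
      folded W_def]
  note A = coercive_inverse[OF A_mat_coercive(1)[OF p' S\<^sub>1 S\<^sub>m \<alpha>] l A_mat_coercive(2)[OF p' S\<^sub>1 S\<^sub>m \<alpha>]]
  have c_le: "c \<le> s" using cross[OF \<alpha>] by (simp add: c_def W_def)
  have c_sym: "\<mu>\<^sub>m \<bullet> (W *v \<mu>\<^sub>1) = c" unfolding c_def by (rule N(4))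
  have "A_mat p l \<mu>\<^sub>1 \<mu>\<^sub>m S\<^sub>1 S\<^sub>m \<alpha> *v \<theta> = b_vec p \<mu>\<^sub>1 \<mu>\<^sub>m \<alpha>"
    unfolding \<theta>_def F_cls_def by (rule A(1))
  \<comment> \<open>The two rank-one terms of \<open>A\<close> contribute multiples of the means and
    are moved to the right-hand side.\<close>
  then have "N_mat p l S\<^sub>1 S\<^sub>m \<alpha> *v \<theta> = (a * (1 - u)) *\<^sub>R \<mu>\<^sub>1 - (b * (1 + v)) *\<^sub>R \<mu>\<^sub>m"
    unfolding A_mat_mult_vec b_vec_def a_def[symmetric] b_def[symmetric] u_def[symmetric]
      v_def[symmetric]
    by (simp add: algebra_simps)
  then have "\<theta> = W *v ((a * (1 - u)) *\<^sub>R \<mu>\<^sub>1 - (b * (1 + v)) *\<^sub>R \<mu>\<^sub>m)"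
    by (metis N(2))
  then have \<theta>: "\<theta> = (a * (1 - u)) *\<^sub>R (W *v \<mu>\<^sub>1) - (b * (1 + v)) *\<^sub>R (W *v \<mu>\<^sub>m)"
    by (simp add: matrix_vector_mult_diff_distrib matrix_vector_mult_scaleR)
  have u: "u = a * (1 - u) * g - b * (1 + v) * c"
    by (subst u_def, subst \<theta>) (simp add: inner_diff_right g_def c_def)
  have v: "v = a * (1 - u) * c - b * (1 + v) * h"
    by (subst v_def, subst \<theta>) (simp add: inner_diff_right h_def c_sym)
  have cs: "c\<^sup>2 \<le> g * h"
  proof (rule nonneg_form_cauchy_schwarz)
    fix x y
    have "0 \<le> (x *\<^sub>R \<mu>\<^sub>1 + y *\<^sub>R \<mu>\<^sub>m) \<bullet> (W *v (x *\<^sub>R \<mu>\<^sub>1 + y *\<^sub>R \<mu>\<^sub>m))" by (rule N(5))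
    also have "\<dots> = x\<^sup>2 * g + 2 * (x * y) * c + y\<^sup>2 * h"
      by (simp add: matrix_vector_right_distrib matrix_vector_mult_scaleR inner_add_left
          inner_add_right c_sym g_def[symmetric] h_def[symmetric] c_def[symmetric]
          power2_eq_square algebra_simps)
    finally show "0 \<le> x\<^sup>2 * g + 2 * (x * y) * c + y\<^sup>2 * h" .
  qed
  have gh: "0 \<le> g" "0 \<le> h" unfolding g_def h_def by (rule N(5))+
  have "z \<bullet> (W *v z) \<le> (norm z)\<^sup>2 / l" for z
  proof -
    have "z \<bullet> (W *v z) \<le> norm z * norm (W *v z)" by (rule norm_cauchy_schwarz)
    also have "\<dots> \<le> norm z * (norm z / l)" by (intro mult_left_mono N(3)) auto
    finally show ?thesis by (simp add: power2_eq_square)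
  qed
  from this[of \<mu>\<^sub>1] this[of \<mu>\<^sub>m] have ghG: "g \<le> G" "h \<le> G"
    using l by (auto simp: g_def h_def G_def add_divide_distrib intro: order_trans)
  note mb = margins_bound[OF ab gh(1) ghG(1) gh(2) ghG(2) cs u v]
  define D where "D = 1 + a * g + b * h + a * b * (g * h - c\<^sup>2)"
  have D: "a * g - b * c \<le> u * D" "b * h - a * c \<le> - v * D" "1 \<le> D" "D \<le> (1 + G)\<^sup>2"
    using mb by (simp_all add: D_def)
  \<comment> \<open>Otherwise \<open>c\<^sup>2 \<le> g * h\<close> would force \<open>c = 0\<close>,
    against \<open>c \<le> s < 0\<close>.\<close>
  have "g \<noteq> 0" "h \<noteq> 0" using cs c_le s by auto
  then have gh_pos: "g > 0" "h > 0" using gh by auto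
  have G: "0 < (1 + G)\<^sup>2" using gh ghG by auto
  have bc: "b * (- s) \<le> - (b * c)" "a * (- s) \<le> - (a * c)"
    using c_le ab by (auto simp: mult_left_mono)
  have bs: "0 \<le> b * (- s)" "0 \<le> a * (- s)" using ab s by (simp_all add: mult_nonneg_nonpos)
  have ag: "0 \<le> a * g" "0 \<le> b * h" using ab gh by auto
  \<comment> \<open>From \<open>0 \<le> w\<close> and \<open>D \<ge> 1\<close> the margin
    \<open>m\<close> is nonnegative, so \<open>D\<close> may be replaced by its upper bound.\<close>
  have scale: "w / (1 + G)\<^sup>2 \<le> m" if "w \<le> m * D" "0 \<le> w" for w m
  proof -
    have "0 \<le> m" using that D(3) by (metis zero_le_mult_iff linorder_not_le order_trans not_one_le_zero)
    then have "m * D \<le> m * (1 + G)\<^sup>2" using D(4) by (rule mult_left_mono[rotated])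
    then show ?thesis using that G by (simp add: field_simps)
  qed
  show "(1 - p) * snd \<alpha> * (- s) / (1 + G)\<^sup>2 \<le> \<mu>\<^sub>1 \<bullet> F \<alpha>"
    using scale[of "b * (- s)" u] D(1) bc bs ag by (simp add: b_def u_def \<theta>_def)
  show "p * fst \<alpha> * (- s) / (1 + G)\<^sup>2 \<le> - (\<mu>\<^sub>m \<bullet> F \<alpha>)"
    using scale[of "a * (- s)" "- v"] D(2) bc bs ag by (simp add: a_def v_def \<theta>_def)
  show "\<mu>\<^sub>1 \<bullet> F \<alpha> > 0" if "fst \<alpha> > 0"
  proof -
    have "0 < a * g" using that p gh_pos by (simp add: a_def)
    then have "0 < u * D" using D(1) bc bs by linarith
    then show ?thesis using D(3) by (simp add: zero_less_mult_iff u_def \<theta>_def)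
  qed
  show "- (\<mu>\<^sub>m \<bullet> F \<alpha>) > 0" if "snd \<alpha> > 0"
  proof -
    have "0 < b * h" using that p gh_pos by (simp add: b_def)
    then have "0 < - v * D" using D(2) bc bs by linarith
    then show ?thesis using D(3) by (simp add: mult_less_0_iff v_def \<theta>_def)
  qed
qed

text \<open>At rate 0 the velocity vanishes. At a positive rate the margin has the right sign, and
  using the actual margin and norm of \<open>F \<alpha>\<close> as bounds puts the success
  probability above 1/2. Covering the whole square makes monotonicity available before the solution
  is confined to a smaller region.\<close>

lemma field_nonneg:
  assumes \<alpha>: "\<alpha> \<in> {0..1} \<times> {0..1}"
  shows "fst (field \<alpha>) \<ge> 0" and "snd (field \<alpha>) \<ge> 0"
proof -
  have "fst \<alpha> * (2 * phat\<^sub>1 \<mu>\<^sub>1 S\<^sub>1 (F \<alpha>) - 1) \<ge> 0"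
  proof (cases "fst \<alpha> = 0")
    case False
    then have "fst \<alpha> > 0" using \<alpha> by auto
    then have "phat\<^sub>1 \<mu>\<^sub>1 S\<^sub>1 (F \<alpha>) \<ge> 1 / 2"
      using phat\<^sub>1_gt_half[OF S\<^sub>1 margins(3)[OF \<alpha>], of "norm (F \<alpha>)" \<mu>\<^sub>1] by fastforce
    then show ?thesis using \<open>fst \<alpha> > 0\<close> by simp
  qed simp
  then have "p * fst \<alpha> * (2 * phat\<^sub>1 \<mu>\<^sub>1 S\<^sub>1 (F \<alpha>) - 1) \<ge> 0"
    using p by (simp add: mult.assoc)
  then show "fst (field \<alpha>) \<ge> 0"
    unfolding walkup_field_def Let_def fst_conv by (rule proj_velocity_nonneg)
  have "snd \<alpha> * (2 * phat\<^sub>m \<mu>\<^sub>m S\<^sub>m (F \<alpha>) - 1) \<ge> 0"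
  proof (cases "snd \<alpha> = 0")
    case False
    then have "snd \<alpha> > 0" using \<alpha> by auto
    then have "phat\<^sub>m \<mu>\<^sub>m S\<^sub>m (F \<alpha>) \<ge> 1 / 2"
      using phat\<^sub>m_gt_half[OF S\<^sub>m margins(4)[OF \<alpha>], of "norm (F \<alpha>)" \<mu>\<^sub>m] by fastforce
    then show ?thesis using \<open>snd \<alpha> > 0\<close> by simp
  qed simp
  then have "(1 - p) * snd \<alpha> * (2 * phat\<^sub>m \<mu>\<^sub>m S\<^sub>m (F \<alpha>) - 1) \<ge> 0"
    using p by (simp add: mult.assoc)
  then show "snd (field \<alpha>) \<ge> 0"
    unfolding walkup_field_def Let_def snd_conv by (rule proj_velocity_nonneg)
qed

lemma field_uniformly_pos:
  assumes xy: "0 < x" "0 < y"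
  shows "\<exists>k>0. \<forall>\<alpha>\<in>{x..1} \<times> {y..1}.
    (fst \<alpha> < 1 \<longrightarrow> fst (field \<alpha>) \<ge> k) \<and> (snd \<alpha> < 1 \<longrightarrow> snd (field \<alpha>) \<ge> k)"
proof -
  have "G \<ge> 0" using l by (simp add: G_def)
  then have G: "0 < (1 + G)\<^sup>2" by auto
  define M where "M = (norm \<mu>\<^sub>1 + norm \<mu>\<^sub>m) / l"
  \<comment> \<open>The margin bound of each class involves the lower bound on the other rate:
    \<open>y\<close> here and \<open>x\<close> in the next line.\<close>
  define e\<^sub>1 where "e\<^sub>1 = (1 - p) * y * (- s) / (1 + G)\<^sup>2"
  define e\<^sub>m where "e\<^sub>m = p * x * (- s) / (1 + G)\<^sup>2"
  have e: "e\<^sub>1 > 0" "e\<^sub>m > 0"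
    unfolding e\<^sub>1_def e\<^sub>m_def using p xy s G by (intro divide_pos_pos mult_pos_pos; simp)+
  obtain \<delta>\<^sub>1 where "\<delta>\<^sub>1 > 0" and \<delta>\<^sub>1: "\<And>\<theta>. norm \<theta> \<le> M \<and> \<mu>\<^sub>1 \<bullet> \<theta> \<ge> e\<^sub>1 \<Longrightarrow> phat\<^sub>1 \<mu>\<^sub>1 S\<^sub>1 \<theta> \<ge> 1 / 2 + \<delta>\<^sub>1"
    using phat\<^sub>1_gt_half[OF S\<^sub>1 e(1)] by blast
  obtain \<delta>\<^sub>m where "\<delta>\<^sub>m > 0" and \<delta>\<^sub>m: "\<And>\<theta>. norm \<theta> \<le> M \<and> - (\<mu>\<^sub>m \<bullet> \<theta>) \<ge> e\<^sub>m \<Longrightarrow> phat\<^sub>m \<mu>\<^sub>m S\<^sub>m \<theta> \<ge> 1 / 2 + \<delta>\<^sub>m"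
    using phat\<^sub>m_gt_half[OF S\<^sub>m e(2)] by blast
  \<comment> \<open>In each entry, the smallest admissible rate with its class weight multiplies the
    excess \<open>2 * \<delta>\<close> in twice the success probability minus 1.\<close>
  define k where "k = min (p * x * (2 * \<delta>\<^sub>1)) ((1 - p) * y * (2 * \<delta>\<^sub>m))"
  have "k > 0" using p xy \<open>\<delta>\<^sub>1 > 0\<close> \<open>\<delta>\<^sub>m > 0\<close> by (simp add: k_def)
  have "(fst \<alpha> < 1 \<longrightarrow> fst (field \<alpha>) \<ge> k) \<and> (snd \<alpha> < 1 \<longrightarrow> snd (field \<alpha>) \<ge> k)"
    if \<alpha>: "\<alpha> \<in> {x..1} \<times> {y..1}" for \<alpha>
  proof -
    have \<alpha>': "\<alpha> \<in> {0..1} \<times> {0..1}" and xy\<alpha>: "x \<le> fst \<alpha>" "y \<le> snd \<alpha>"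
      using \<alpha> xy by (auto simp: mem_Times_iff)
    have "e\<^sub>1 \<le> (1 - p) * snd \<alpha> * (- s) / (1 + G)\<^sup>2" "e\<^sub>m \<le> p * fst \<alpha> * (- s) / (1 + G)\<^sup>2"
      unfolding e\<^sub>1_def e\<^sub>m_def using p s xy\<alpha>
      by (intro divide_right_mono mult_right_mono mult_left_mono; simp)+
    then have F_ge: "e\<^sub>1 \<le> \<mu>\<^sub>1 \<bullet> F \<alpha>" "e\<^sub>m \<le> - (\<mu>\<^sub>m \<bullet> F \<alpha>)"
      using margins(1,2)[OF \<alpha>'] by linarith+
    have "norm (F \<alpha>) \<le> M" using norm_F_le[OF \<alpha>'] by (simp only: M_def)
    then have ph: "2 * \<delta>\<^sub>1 \<le> 2 * phat\<^sub>1 \<mu>\<^sub>1 S\<^sub>1 (F \<alpha>) - 1" "2 * \<delta>\<^sub>m \<le> 2 * phat\<^sub>m \<mu>\<^sub>m S\<^sub>m (F \<alpha>) - 1"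
      using \<delta>\<^sub>1[OF conjI[OF _ F_ge(1)]] \<delta>\<^sub>m[OF conjI[OF _ F_ge(2)]] by linarith+
    have "p * x * (2 * \<delta>\<^sub>1) \<le> p * fst \<alpha> * (2 * phat\<^sub>1 \<mu>\<^sub>1 S\<^sub>1 (F \<alpha>) - 1)"
      using p xy xy\<alpha> ph \<open>\<delta>\<^sub>1 > 0\<close> by (intro mult_mono) auto
    moreover have "(1 - p) * y * (2 * \<delta>\<^sub>m) \<le> (1 - p) * snd \<alpha> * (2 * phat\<^sub>m \<mu>\<^sub>m S\<^sub>m (F \<alpha>) - 1)"
      using p xy xy\<alpha> ph \<open>\<delta>\<^sub>m > 0\<close> by (intro mult_mono) auto
    ultimately show ?thesis
      using xy xy\<alpha> by (simp add: walkup_field_def Let_def proj_velocity_interior k_def min_le_iff_disj)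
  qed
  then show ?thesis using \<open>k > 0\<close> by blast
qed

lemma solution_tendsto:
  assumes sol: "walkup_solution p l \<mu>\<^sub>1 \<mu>\<^sub>m S\<^sub>1 S\<^sub>m \<alpha>" and init: "\<alpha> 0 \<in> {0<..<1} \<times> {0<..<1}"
  shows "(\<alpha> \<longlongrightarrow> (1, 1)) at_top"
proof -
  have range: "\<And>t. t \<ge> 0 \<Longrightarrow> \<alpha> t \<in> {0..1} \<times> {0..1}"
    and ac: "\<And>T. T \<ge> 0 \<Longrightarrow> abs_cont_on {0..T} \<alpha>"
    and ae: "AE t in lebesgue. t \<ge> 0 \<longrightarrow> (\<alpha> has_vector_derivative field (\<alpha> t)) (at t within {0..})"
    using sol by (auto simp: walkup_solution_def)
  have norm_le: "norm (fst z) \<le> norm z" "norm (snd z) \<le> norm z" for z :: "real \<times> real"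
    using norm_fst_le[of "fst z" "snd z"] norm_snd_le[of "snd z" "fst z"] by simp_all
  have ac_fst: "abs_cont_on {0..T} (\<lambda>t. fst (\<alpha> t))" if "T \<ge> 0" for T
    by (rule abs_cont_on_mono[OF ac[OF that] order_refl]) (simp only: fst_diff[symmetric] norm_le)
  have ac_snd: "abs_cont_on {0..T} (\<lambda>t. snd (\<alpha> t))" if "T \<ge> 0" for T
    by (rule abs_cont_on_mono[OF ac[OF that] order_refl]) (simp only: snd_diff[symmetric] norm_le)
  have ae_fst: "AE t in lebesgue. t \<ge> 0 \<longrightarrow>
      ((\<lambda>t. fst (\<alpha> t)) has_real_derivative fst (field (\<alpha> t))) (at t within {0..})"
    using ae by (rule AE_mp) (auto simp: has_real_derivative_iff_has_vector_derivative
        intro!: AE_I2 bounded_linear.has_vector_derivative[OF bounded_linear_fst])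
  have ae_snd: "AE t in lebesgue. t \<ge> 0 \<longrightarrow>
      ((\<lambda>t. snd (\<alpha> t)) has_real_derivative snd (field (\<alpha> t))) (at t within {0..})"
    using ae by (rule AE_mp) (auto simp: has_real_derivative_iff_has_vector_derivative
        intro!: AE_I2 bounded_linear.has_vector_derivative[OF bounded_linear_snd])
  \<comment> \<open>The increment estimate with slope 0.\<close>
  have mono_fst: "fst (\<alpha> s') \<le> fst (\<alpha> t)" if "0 \<le> s'" "s' \<le> t" for s' t
  proof -
    have "0 * (t - s') \<le> fst (\<alpha> t) - fst (\<alpha> s')"
      using ac_fst that
    proof (rule abs_cont_halfline_increment_ge)
      show "AE \<tau> in lebesgue. \<tau> \<in> {s'..t} \<longrightarrow>
        (\<exists>D\<ge>0. ((\<lambda>t. fst (\<alpha> t)) has_real_derivative D) (at \<tau> within {0..}))"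
        using ae_fst
      proof (rule AE_mp, intro AE_I2 impI)
        fix \<tau> assume "\<tau> \<ge> 0 \<longrightarrow>
          ((\<lambda>t. fst (\<alpha> t)) has_real_derivative fst (field (\<alpha> \<tau>))) (at \<tau> within {0..})"
          and "\<tau> \<in> {s'..t}"
        moreover from this that have "0 \<le> \<tau>" by simp
        ultimately show "\<exists>D\<ge>0. ((\<lambda>t. fst (\<alpha> t)) has_real_derivative D) (at \<tau> within {0..})"
          using field_nonneg(1)[OF range] by blast
      qed
    qed
    then show ?thesis by simp
  qed
  have mono_snd: "snd (\<alpha> s') \<le> snd (\<alpha> t)" if "0 \<le> s'" "s' \<le> t" for s' t
  proof -
    have "0 * (t - s') \<le> snd (\<alpha> t) - snd (\<alpha> s')"
      using ac_snd that
    proof (rule abs_cont_halfline_increment_ge)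
      show "AE \<tau> in lebesgue. \<tau> \<in> {s'..t} \<longrightarrow>
        (\<exists>D\<ge>0. ((\<lambda>t. snd (\<alpha> t)) has_real_derivative D) (at \<tau> within {0..}))"
        using ae_snd
      proof (rule AE_mp, intro AE_I2 impI)
        fix \<tau> assume "\<tau> \<ge> 0 \<longrightarrow>
          ((\<lambda>t. snd (\<alpha> t)) has_real_derivative snd (field (\<alpha> \<tau>))) (at \<tau> within {0..})"
          and "\<tau> \<in> {s'..t}"
        moreover from this that have "0 \<le> \<tau>" by simp
        ultimately show "\<exists>D\<ge>0. ((\<lambda>t. snd (\<alpha> t)) has_real_derivative D) (at \<tau> within {0..})"
          using field_nonneg(2)[OF range] by blast
      qed
    qed
    then show ?thesis by simp
  qed
  define x where "x = fst (\<alpha> 0)"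
  define y where "y = snd (\<alpha> 0)"
  have "0 < x" "0 < y" using init by (auto simp: x_def y_def mem_Times_iff)
  from field_uniformly_pos[OF this] obtain k where "k > 0"
    and k: "\<And>\<beta>. \<beta> \<in> {x..1} \<times> {y..1} \<Longrightarrow>
      (fst \<beta> < 1 \<longrightarrow> fst (field \<beta>) \<ge> k) \<and> (snd \<beta> < 1 \<longrightarrow> snd (field \<beta>) \<ge> k)"
    by blast
  \<comment> \<open>Monotonicity keeps both rates above their initial values, so the single constant
    \<open>k\<close> is valid for all times.\<close>
  have region: "\<alpha> t \<in> {x..1} \<times> {y..1}" if "t \<ge> 0" for t
    using range[OF that] mono_fst[of 0 t] mono_snd[of 0 t] that by (simp add: x_def y_def mem_Times_iff)
  have le1: "fst (\<alpha> t) \<le> 1" "snd (\<alpha> t) \<le> 1" if "t \<ge> 0" for t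
    using range[OF that] by (auto simp: mem_Times_iff)
  have "AE t in lebesgue. t \<ge> 0 \<and> fst (\<alpha> t) < 1 \<longrightarrow>
      (\<exists>D\<ge>k. ((\<lambda>t. fst (\<alpha> t)) has_real_derivative D) (at t within {0..}))"
    using ae_fst by (rule AE_mp) (use k[OF region] in \<open>fastforce intro!: AE_I2\<close>)
  from nondecreasing_eventually_one[OF ac_fst le1(1) mono_fst \<open>k > 0\<close> this]
  have "eventually (\<lambda>t. fst (\<alpha> t) = 1) at_top" .
  moreover have "AE t in lebesgue. t \<ge> 0 \<and> snd (\<alpha> t) < 1 \<longrightarrow>
      (\<exists>D\<ge>k. ((\<lambda>t. snd (\<alpha> t)) has_real_derivative D) (at t within {0..}))"
    using ae_snd by (rule AE_mp) (use k[OF region] in \<open>fastforce intro!: AE_I2\<close>)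
  from nondecreasing_eventually_one[OF ac_snd le1(2) mono_snd \<open>k > 0\<close> this]
  have "eventually (\<lambda>t. snd (\<alpha> t) = 1) at_top" .
  ultimately have "eventually (\<lambda>t. \<alpha> t = (1, 1)) at_top"
    by eventually_elim (simp add: prod_eq_iff)
  then show ?thesis by (rule tendsto_eventually)
qed

end

theorem theorem4p3:
  fixes p l :: real
    and \<mu>\<^sub>1 \<mu>\<^sub>m :: "real^'d"
    and S\<^sub>1 S\<^sub>m :: "real^'d^'d"
  assumes "0 < p" and "p < 1"
    and "l > 0"
    and "\<not> (\<exists>c::real. \<mu>\<^sub>1 = c *\<^sub>R \<mu>\<^sub>m \<or> \<mu>\<^sub>m = c *\<^sub>R \<mu>\<^sub>1)"
    and "sym_pos_def S\<^sub>1" and "sym_pos_def S\<^sub>m"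
    and "(SUP \<alpha> \<in> {0..1} \<times> {0..1}. \<mu>\<^sub>1 \<bullet> (matrix_inv (N_mat p l S\<^sub>1 S\<^sub>m \<alpha>) *v \<mu>\<^sub>m)) < 0"
  shows "\<forall>\<alpha>. walkup_solution p l \<mu>\<^sub>1 \<mu>\<^sub>m S\<^sub>1 S\<^sub>m \<alpha> \<and> \<alpha> 0 \<in> {0<..<1} \<times> {0<..<1}
           \<longrightarrow> (\<alpha> \<longlongrightarrow> (1, 1)) at_top"
proof -
  let ?c = "\<lambda>\<alpha>. \<mu>\<^sub>1 \<bullet> (matrix_inv (N_mat p l S\<^sub>1 S\<^sub>m \<alpha>) *v \<mu>\<^sub>m)"
  \<comment> \<open>A real supremum bounds its family only if the family is bounded above;
    Cauchy-Schwarz and the inverse bound \<open>1 / l\<close> provide this.\<close>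
  have bound: "?c \<alpha> \<le> norm \<mu>\<^sub>1 * (norm \<mu>\<^sub>m / l)" if "\<alpha> \<in> {0..1} \<times> {0..1}" for \<alpha>
  proof -
    have "?c \<alpha> \<le> norm \<mu>\<^sub>1 * norm (matrix_inv (N_mat p l S\<^sub>1 S\<^sub>m \<alpha>) *v \<mu>\<^sub>m)"
      by (rule norm_cauchy_schwarz)
    also have "\<dots> \<le> norm \<mu>\<^sub>1 * (norm \<mu>\<^sub>m / l)"
      using assms that by (intro mult_left_mono coercive_inverse(3) N_mat_coercive) auto
    finally show ?thesis .
  qed
  have "bdd_above (?c ` ({0..1} \<times> {0..1}))"
    by (rule bdd_aboveI2[OF bound])
  then have "?c \<alpha> \<le> (SUP \<alpha> \<in> {0..1} \<times> {0..1}. ?c \<alpha>)" if "\<alpha> \<in> {0..1} \<times> {0..1}" for \<alpha>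
    using that by (intro cSUP_upper)
  with assms interpret walkup p l "SUP \<alpha> \<in> {0..1} \<times> {0..1}. ?c \<alpha>" \<mu>\<^sub>1 \<mu>\<^sub>m S\<^sub>1 S\<^sub>m
    by unfold_locales
  show ?thesis
    by (intro allI impI, elim conjE, rule solution_tendsto)
qed

end
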